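(* Let $n\in\mathbb{N}_+$, $r_1,\ldots,r_n\ge 2$ integers, $s,t\in[n]$. Let $H(d)=\dim_{\Bbbk}\big(R/\widetilde{I}^{\langle s,t\rangle}\big)_d$ denote the Hilbert function of $R/\widetilde{I}^{\langle s,t\rangle}$. If $2\le s\le t$ then $$H(d)=\Big(d\sum_{j=1}^s(r_j-1)+1\Big)\binom{d+r_{t+1}\cdots r_n-1}{d}\prod_{i=s+1}^t\binom{d+r_i-1}{d},$$ whereas if $s\ge t$ and $s\ge 2$ then $$H(d)=\Big(d\sum_{j=1}^s(r_j-1)+1\Big)\binom{d+r_{s+1}\cdots r_n-1}{d}.$$ Here an empty product equals $1$.
   Context: Notation: $[r]=\{1,\ldots,r\}$, $\mathcal{N}=[r_1]\times\cdots\times[r_n]$, $\Bbbk$ is an arbitrary field. Two indices $a,b\in\mathcal{N}$ are $s$-equivalent if $\sum_{i=1}^s a_i=\sum_{i=1}^s b_i$ and $a_i=b_i$ for $i=s+1,\ldots,n$. $R=\Bbbk[x_a: a\in\mathcal{N}]$ is the (standard graded) polynomial ring where the variables are identified by $x_a=x_b$ if and only if $a,b$ are $s$-equivalent (so variables correspond bijectively to $s$-equivalence classes). For $i\in[n]$ and $a,b\in\mathcal{N}$, $\mathrm{sw}(i,a,b)\in\mathcal{N}$ is obtained from $a$ by replacing its $i$-th component by $b_i$, and $f_{i,a,b}=x_ax_b-x_{\mathrm{sw}(i,a,b)}x_{\mathrm{sw}(i,b,a)}$. The ideal $\widetilde{I}^{\langle s,t\rangle}\subseteq R$ is generated by all $f_{i,a,b}$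 with $a,b\in\mathcal{N}$ and $i\in[t]$. *)

theory Defs
  imports
    "HOL-Library.Poly_Mapping"
    "HOL-Library.FuncSet"
    "HOL-Algebra.QuotRing"
    "HOL-Algebra.Embedded_Algebras"
begin

text \<open>Monomials in the variables \<^typ>\<open>'v\<close> are finitely supported exponent functions, polynomials
  are finitely supported functions from monomials to coefficients; multiplication on
  \<^type>\<open>poly_mapping\<close> is convolution, hence the usual product of polynomials.\<close>

type_synonym 'v monomial = "'v \<Rightarrow>\<^sub>0 nat"
type_synonym ('v, 'k) mpoly = "'v monomial \<Rightarrow>\<^sub>0 'k"

definition mon_deg :: "'v monomial \<Rightarrow> nat" where
  "mon_deg m = (\<Sum>v \<in> Poly_Mapping.keys m. Poly_Mapping.lookup m v)"

definition Var :: "'v \<Rightarrow> ('v, 'k::field) mpoly" where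
  "Var v = Poly_Mapping.single (Poly_Mapping.single v 1) 1"

definition Const :: "'k \<Rightarrow> ('v, 'k::field) mpoly" where
  "Const c = Poly_Mapping.single 0 c"

definition poly_ring :: "'v set \<Rightarrow> ('v, 'k::field) mpoly ring" where
  "poly_ring V =
     \<lparr> carrier = {p. \<forall>m \<in> Poly_Mapping.keys p. Poly_Mapping.keys m \<subseteq> V},
       monoid.mult = (*), one = 1, zero = 0, add = (+) \<rparr>"

definition homog_part :: "'v set \<Rightarrow> nat \<Rightarrow> ('v, 'k::field) mpoly set" where
  "homog_part V d = {p \<in> carrier (poly_ring V). \<forall>m \<in> Poly_Mapping.keys p. mon_deg m = d}"

text \<open>For a homogeneous ideal \<open>J\<close> of \<open>R = poly_ring V\<close>, the degree-\<open>d\<close> component of \<open>R/J\<close> is the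
  image of \<open>R\<^sub>d\<close>. Its dimension is taken over the image of the coefficient field in \<open>R/J\<close>.\<close>

definition hilbert_function :: "'v set \<Rightarrow> ('v, 'k::field) mpoly set \<Rightarrow> nat \<Rightarrow> nat" where
  "hilbert_function V J d =
     (let R = poly_ring V; \<pi> = (\<lambda>p. J +>\<^bsub>R\<^esub> p)
      in (ring.dim (R Quot J) over (\<pi> ` range Const)) (\<pi> ` homog_part V d))"

text \<open>Indices \<open>a \<in> [r\<^sub>1] \<times> \<cdots> \<times> [r\<^sub>n]\<close> are extensional functions on \<open>{1..n}\<close>.\<close>

definition index_set :: "nat \<Rightarrow> (nat \<Rightarrow> nat) \<Rightarrow> (nat \<Rightarrow> nat) set" where
  "index_set n r = (\<Pi>\<^sub>E i \<in> {1..n}. {1..r i})"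

definition s_equiv :: "nat \<Rightarrow> (nat \<Rightarrow> nat) \<Rightarrow> nat \<Rightarrow> ((nat \<Rightarrow> nat) \<times> (nat \<Rightarrow> nat)) set" where
  "s_equiv n r s = {(a, b). a \<in> index_set n r \<and> b \<in> index_set n r \<and>
     (\<Sum>i=1..s. a i) = (\<Sum>i=1..s. b i) \<and> (\<forall>i \<in> {s+1..n}. a i = b i)}"

definition var_set :: "nat \<Rightarrow> (nat \<Rightarrow> nat) \<Rightarrow> nat \<Rightarrow> (nat \<Rightarrow> nat) set set" where
  "var_set n r s = index_set n r // s_equiv n r s"

definition xvar ::
    "nat \<Rightarrow> (nat \<Rightarrow> nat) \<Rightarrow> nat \<Rightarrow> (nat \<Rightarrow> nat) \<Rightarrow> ((nat \<Rightarrow> nat) set, 'k::field) mpoly" where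
  "xvar n r s a = Var (s_equiv n r s `` {a})"

definition sw :: "nat \<Rightarrow> (nat \<Rightarrow> nat) \<Rightarrow> (nat \<Rightarrow> nat) \<Rightarrow> (nat \<Rightarrow> nat)" where
  "sw i a b = a(i := b i)"

definition f_gen ::
    "nat \<Rightarrow> (nat \<Rightarrow> nat) \<Rightarrow> nat \<Rightarrow> nat \<Rightarrow> (nat \<Rightarrow> nat) \<Rightarrow> (nat \<Rightarrow> nat)
      \<Rightarrow> ((nat \<Rightarrow> nat) set, 'k::field) mpoly" where
  "f_gen n r s i a b =
     xvar n r s a * xvar n r s b - xvar n r s (sw i a b) * xvar n r s (sw i b a)"

definition I_tilde ::
    "nat \<Rightarrow> (nat \<Rightarrow> nat) \<Rightarrow> nat \<Rightarrow> nat \<Rightarrow> ((nat \<Rightarrow> nat) set, 'k::field) mpoly set" where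
  "I_tilde n r s t =
     genideal (poly_ring (var_set n r s))
       {f_gen n r s i a b | i a b. i \<in> {1..t} \<and> a \<in> index_set n r \<and> b \<in> index_set n r}"

end

theory Submission
  imports Defs "HOL-Library.Multiset"
begin

text \<open>
  Each generator is a difference of two monomials, so the ideal cuts the set of monomials into
  classes: two monomials are identified when one can be reached from the other by the swaps that
  the generators encode. The monomials of degree \<open>d\<close>, taken one from each class, form a basis of the
  degree-\<open>d\<close> component of the quotient, so \<open>H(d)\<close> is the number of classes. The proof finds a complete
  invariant for the classes and counts its values.

  Write a monomial of degree \<open>d\<close> as a multiset \<open>A\<close> of \<open>d\<close> indices. A variable remembers from an index
  \<open>a\<close> only the head \<open>a\<^sub>1 + \<dots> + a\<^sub>s\<close> and the tail \<open>(a\<^sub>s\<^sub>+\<^sub>1, \<dots>, a\<^sub>n)\<close>. A swap in a position \<open>i \<le> s\<close> keeps the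
  sum of all heads and does not touch the tails. A swap in a position \<open>i > s\<close> only permutes the
  \<open>i\<close>-th coordinates among the members of \<open>A\<close>; the coordinates after \<open>u = max s t\<close> are never swapped, so they
  travel together. Hence the following tally of \<open>A\<close> is invariant: the sum of the heads, the multiset
  of \<open>i\<close>-th coordinates for each \<open>i\<close> with \<open>s < i \<le> t\<close>, and the multiset of the restrictions to
  \<open>{u+1..n}\<close>. The two cases of the theorem are \<open>u = t\<close> and \<open>u = s\<close>, and this description covers both.

  Conversely, multisets with equal tallies are connected (\<open>fibres_connected\<close>). Given a member \<open>b\<close> of the
  target, swaps in the positions \<open>s < i \<le> t\<close> produce a member of the source with the tail of \<open>b\<close>, and
  then head units are moved between this member and the others until its head is that of \<open>b\<close>;
  removing \<open>b\<close> from both sides leaves a smaller instance. Moving head units while keeping the tails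
  in place is the delicate point (\<open>conn_transfer\<close>). A swap in position 1 exchanges the first
  coordinates, so it moves only an amount that is the difference of two admissible
  first coordinates, and a single swap need not suffice. It is enough that every
  pair of heads can be balanced by swaps (\<open>balance_pairs\<close>), because two pairs with the same sum then
  meet at the same balanced pair. This is where \<open>s \<ge> 2\<close> is essential: for \<open>s = 1\<close> the head is the first coordinate,
  and a swap only exchanges the two heads.

  On the algebraic side (\<open>hilbert_function_eq_card_fibres\<close>) connectedness shows that one monomial per
  tally spans, and independence holds because summing the coefficients over a fibre of the tally map
  is a linear functional that vanishes on the ideal. Finally \<open>card_tallies\<close> counts: the sum of heads takes
  every value from \<open>s d\<close> to \<open>(r\<^sub>1 + \<dots> + r\<^sub>s) d\<close>, and each of the other components is an arbitrary multiset of
  size \<open>d\<close>, independently of the rest (\<open>tallies_attained\<close>).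
\<close>

section \<open>Polynomial rings as rings of finitely supported functions\<close>

lemma poly_ring_simps:
  "monoid.mult (poly_ring V) = (*)" "one (poly_ring V) = 1"
  "zero (poly_ring V) = 0" "add (poly_ring V) = (+)"
  by (simp_all add: poly_ring_def)

lemma carrier_poly_ring:
  "p \<in> carrier (poly_ring V) \<longleftrightarrow> (\<forall>m \<in> Poly_Mapping.keys p. Poly_Mapping.keys m \<subseteq> V)"
  by (simp add: poly_ring_def)

lemma zero_in_poly_ring: "0 \<in> carrier (poly_ring V)"
  by (simp add: carrier_poly_ring)

lemma one_in_poly_ring: "1 \<in> carrier (poly_ring V)"
  by (auto simp: carrier_poly_ring)

lemma add_in_poly_ring:
  assumes "p \<in> carrier (poly_ring V)" "q \<in> carrier (poly_ring V)"
  shows "p + q \<in> carrier (poly_ring V)"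
  using assms keys_add[of p q] by (auto simp: carrier_poly_ring)

lemma uminus_in_poly_ring:
  assumes "p \<in> carrier (poly_ring V)"
  shows "- p \<in> carrier (poly_ring V)"
  using assms by (auto simp: carrier_poly_ring in_keys_iff)

lemma diff_in_poly_ring:
  assumes "p \<in> carrier (poly_ring V)" "q \<in> carrier (poly_ring V)"
  shows "p - q \<in> carrier (poly_ring V)"
  using add_in_poly_ring[OF assms(1) uminus_in_poly_ring[OF assms(2)]] by simp

lemma mult_in_poly_ring:
  assumes "p \<in> carrier (poly_ring V)" "q \<in> carrier (poly_ring V)"
  shows "p * q \<in> carrier (poly_ring V)"
  unfolding carrier_poly_ring
proof
  fix m assume "m \<in> Poly_Mapping.keys (p * q)"
  then obtain a b where "m = a + b" "a \<in> Poly_Mapping.keys p" "b \<in> Poly_Mapping.keys q"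
    using keys_mult[of p q] by blast
  then show "Poly_Mapping.keys m \<subseteq> V"
    using assms keys_add[of a b] unfolding carrier_poly_ring by blast
qed

lemma single_in_poly_ring:
  assumes "Poly_Mapping.keys m \<subseteq> V"
  shows "Poly_Mapping.single m c \<in> carrier (poly_ring V)"
  using assms by (auto simp: carrier_poly_ring)

lemma Const_in_poly_ring: "Const c \<in> carrier (poly_ring V)"
  unfolding Const_def by (rule single_in_poly_ring) simp

lemma poly_ring_cring: "cring (poly_ring V :: ('v, 'k::field) mpoly ring)"
proof (rule cringI)
  show "abelian_group (poly_ring V :: ('v, 'k) mpoly ring)"
  proof (rule abelian_groupI)
    fix x :: "('v, 'k) mpoly" assume "x \<in> carrier (poly_ring V)"
    then show "\<exists>y\<in>carrier (poly_ring V). y \<oplus>\<^bsub>poly_ring V\<^esub> x = \<zero>\<^bsub>poly_ring V\<^esub>"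
      by (intro bexI[of _ "- x"]) (simp_all add: poly_ring_simps uminus_in_poly_ring)
  qed (simp_all add: poly_ring_simps zero_in_poly_ring add_in_poly_ring add_ac)
  show "Group.comm_monoid (poly_ring V :: ('v, 'k) mpoly ring)"
    by (rule comm_monoidI)
      (simp_all add: poly_ring_simps one_in_poly_ring mult_in_poly_ring mult_ac)
qed (simp add: poly_ring_simps algebra_simps)

lemma poly_ring_minus:
  assumes "p \<in> carrier (poly_ring V)" "q \<in> carrier (poly_ring V)"
  shows "p \<ominus>\<^bsub>poly_ring V\<^esub> q = p - q"
proof -
  interpret cring "poly_ring V" by (rule poly_ring_cring)
  have "\<ominus>\<^bsub>poly_ring V\<^esub> q = - q"
    using assms(2) by (intro minus_equality) (simp_all add: poly_ring_simps uminus_in_poly_ring)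
  then show ?thesis by (simp add: a_minus_def poly_ring_simps)
qed

lemma Const_subfield:
  "subfield (range (Const :: 'k::field \<Rightarrow> ('v, 'k) mpoly)) (poly_ring V)"
proof -
  interpret cring "poly_ring V :: ('v, 'k) mpoly ring" by (rule poly_ring_cring)
  let ?K = "range (Const :: 'k \<Rightarrow> ('v, 'k) mpoly)"
  have "subring ?K (poly_ring V)"
  proof (rule subringI)
    fix h assume "h \<in> ?K"
    then obtain c where c: "h = Const c" by blast
    have "\<ominus>\<^bsub>poly_ring V\<^esub> h = Const (- c)"
      unfolding c by (rule minus_equality)
        (simp_all add: poly_ring_simps Const_in_poly_ring, simp add: Const_def flip: single_add)
    then show "\<ominus>\<^bsub>poly_ring V\<^esub> h \<in> ?K" by simp
  next
    show "\<one>\<^bsub>poly_ring V\<^esub> \<in> ?K"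
      by (auto simp: poly_ring_simps Const_def intro!: image_eqI[of _ _ 1])
  qed (auto simp: poly_ring_simps Const_in_poly_ring, auto simp: Const_def mult_single simp flip: single_add)
  then have "cring (poly_ring V \<lparr>carrier := ?K\<rparr>)"
    using subcring_iff[OF subringE(1)] subcringI' by blast
  then have "field (poly_ring V \<lparr>carrier := ?K\<rparr>)"
  proof (rule cring.cring_fieldI2)
    show "\<zero>\<^bsub>poly_ring V\<lparr>carrier := ?K\<rparr>\<^esub> \<noteq> \<one>\<^bsub>poly_ring V\<lparr>carrier := ?K\<rparr>\<^esub>"
      by (simp add: poly_ring_simps)
  next
    fix a assume "a \<in> carrier (poly_ring V \<lparr>carrier := ?K\<rparr>)"
      "a \<noteq> \<zero>\<^bsub>poly_ring V\<lparr>carrier := ?K\<rparr>\<^esub>"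
    then obtain c where c: "a = Const c" "a \<noteq> 0" by (auto simp: poly_ring_simps)
    then have "c \<noteq> 0" by (auto simp: Const_def)
    with c show "\<exists>b\<in>carrier (poly_ring V \<lparr>carrier := ?K\<rparr>).
      a \<otimes>\<^bsub>poly_ring V \<lparr>carrier := ?K\<rparr>\<^esub> b = \<one>\<^bsub>poly_ring V \<lparr>carrier := ?K\<rparr>\<^esub>"
      by (auto simp: poly_ring_simps Const_def mult_single intro!: exI[of _ "inverse c"])
  qed
  then show ?thesis
    by (rule subfield_iff) (auto simp: Const_in_poly_ring)
qed

section \<open>Linear functionals on polynomials\<close>

text \<open>The linear functional on polynomials that takes the value \<open>g m\<close> at the monomial \<open>m\<close>.\<close>

definition functional :: "('v monomial \<Rightarrow> 'k) \<Rightarrow> ('v, 'k::field) mpoly \<Rightarrow> 'k" where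
  "functional g p = (\<Sum>m \<in> Poly_Mapping.keys p. Poly_Mapping.lookup p m * g m)"

lemma functional_add: "functional g (p + q) = functional g p + functional g q"
  unfolding functional_def by (rule setsum_keys_plus_distrib) (simp_all add: algebra_simps)

lemma functional_single: "functional g (Poly_Mapping.single m c) = c * g m"
  by (simp add: functional_def)

lemma functional_zero: "functional g 0 = 0"
  by (simp add: functional_def)

lemma functional_uminus: "functional g (- p) = - functional g p"
  using functional_add[of g p "- p"] by (simp add: functional_zero add_eq_0_iff)

lemma poly_mapping_eq_sum_singles:
  "p = (\<Sum>m \<in> Poly_Mapping.keys p. Poly_Mapping.single m (Poly_Mapping.lookup p m))"
  by (rule poly_mapping_eqI)
    (auto simp: lookup_sum lookup_single when_def in_keys_iff sum.delta)

lemma functional_sum: "functional g (\<Sum>i \<in> A. p i) = (\<Sum>i \<in> A. functional g (p i))"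
  by (induction A rule: infinite_finite_induct) (simp_all add: functional_add functional_zero)

text \<open>Multiplying by a monomial translates the functional. This is what makes the common kernel of a
  translation-invariant family of functionals an ideal.\<close>

lemma functional_single_mult:
  "functional g (Poly_Mapping.single m c * q) = c * functional (\<lambda>u. g (m + u)) q"
proof -
  have "functional g (Poly_Mapping.single m c * q) = functional g (\<Sum>u \<in> Poly_Mapping.keys q.
      Poly_Mapping.single m c * Poly_Mapping.single u (Poly_Mapping.lookup q u))"
    by (subst poly_mapping_eq_sum_singles[of q]) (simp add: sum_distrib_left)
  also have "\<dots> = (\<Sum>u \<in> Poly_Mapping.keys q. c * Poly_Mapping.lookup q u * g (m + u))"
    by (simp add: functional_sum functional_single mult_single)
  also have "\<dots> = c * functional (\<lambda>u. g (m + u)) q"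
    by (simp add: functional_def sum_distrib_left mult.assoc)
  finally show ?thesis .
qed

definition constant_on_fibres :: "('v \<Rightarrow> 'w) \<Rightarrow> ('v \<Rightarrow> 'k) \<Rightarrow> bool" where
  "constant_on_fibres \<phi> g \<longleftrightarrow> (\<forall>u v. \<phi> u = \<phi> v \<longrightarrow> g u = g v)"

text \<open>For a map \<open>\<phi>\<close> on monomials these are the polynomials whose coefficients sum to \<open>0\<close> over every fibre
  of \<open>\<phi>\<close>. Quantifying over all functionals whose weights are constant on the fibres, and not only over the
  indicators of single fibres, keeps the family closed under translation. When \<open>\<phi>\<close> is a monoid
  homomorphism this is the toric ideal of \<open>\<phi>\<close>.\<close>

definition fibre_null :: "'v set \<Rightarrow> ('v monomial \<Rightarrow> 'w) \<Rightarrow> ('v, 'k::field) mpoly set" where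
  "fibre_null V \<phi> = {p \<in> carrier (poly_ring V).
     \<forall>g. constant_on_fibres \<phi> g \<longrightarrow> functional g p = 0}"

lemma fibre_null_ideal:
  assumes compat: "\<And>u v m. \<phi> u = \<phi> v \<Longrightarrow> \<phi> (m + u) = \<phi> (m + v)"
  shows "ideal (fibre_null V \<phi> :: ('v, 'k::field) mpoly set) (poly_ring V)"
proof -
  interpret cring "poly_ring V :: ('v, 'k) mpoly ring" by (rule poly_ring_cring)
  have mult: "p * q \<in> fibre_null V \<phi>"
    if q: "q \<in> fibre_null V \<phi>" and p: "p \<in> carrier (poly_ring V)" for p q :: "('v, 'k) mpoly"
  proof -
    have "functional g (p * q) = 0" if g: "constant_on_fibres \<phi> g" for g
    proof -
      have "p * q = (\<Sum>m \<in> Poly_Mapping.keys p. Poly_Mapping.single m (Poly_Mapping.lookup p m) * q)"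
        by (subst poly_mapping_eq_sum_singles[of p]) (simp add: sum_distrib_right)
      moreover have "functional (\<lambda>u. g (m + u)) q = 0" for m
      proof -
        have "constant_on_fibres \<phi> (\<lambda>u. g (m + u))"
          using g compat[of _ _ m] unfolding constant_on_fibres_def by blast
        then show ?thesis using q by (simp add: fibre_null_def)
      qed
      ultimately show ?thesis
        by (simp add: functional_sum functional_single_mult)
    qed
    then show ?thesis
      using p q by (simp add: fibre_null_def mult_in_poly_ring)
  qed
  have mult': "q * p \<in> fibre_null V \<phi>"
    if q: "q \<in> fibre_null V \<phi>" and p: "p \<in> carrier (poly_ring V)" for p q :: "('v, 'k) mpoly"
    using mult[OF that] by (simp add: mult.commute)
  have "subgroup (fibre_null V \<phi> :: ('v, 'k) mpoly set) (add_monoid (poly_ring V))"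
  proof (rule add.subgroupI)
    fix p :: "('v, 'k) mpoly" assume p: "p \<in> fibre_null V \<phi>"
    then have "\<ominus>\<^bsub>poly_ring V\<^esub> p = - p"
      by (intro minus_equality)
        (simp_all add: fibre_null_def poly_ring_simps uminus_in_poly_ring)
    then show "\<ominus>\<^bsub>poly_ring V\<^esub> p \<in> fibre_null V \<phi>"
      using p by (simp add: fibre_null_def uminus_in_poly_ring functional_uminus)
  next
    show "(fibre_null V \<phi> :: ('v, 'k) mpoly set) \<noteq> {}"
      using zero_in_poly_ring functional_zero by (fastforce simp: fibre_null_def)
  qed (auto simp: fibre_null_def poly_ring_simps add_in_poly_ring functional_add)
  then show ?thesis
    by (intro idealI ring_axioms)
      (simp_all add: poly_ring_simps mult mult')
qed

section \<open>Hilbert functions of toric ideals count fibres\<close>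

definition monomials_of_degree :: "'v set \<Rightarrow> nat \<Rightarrow> 'v monomial set" where
  "monomials_of_degree V d = {m. Poly_Mapping.keys m \<subseteq> V \<and> mon_deg m = d}"

lemma combine_Const_monomials:
  "ring.combine (poly_ring V) (map Const cs) (map (\<lambda>m. Poly_Mapping.single m 1) ms) =
    (\<Sum>(c, m) \<leftarrow> zip cs ms. Poly_Mapping.single m (c :: 'k::field))"
proof -
  interpret cring "poly_ring V" by (rule poly_ring_cring)
  show ?thesis
    by (induction cs ms rule: list_induct2')
      (simp_all add: poly_ring_simps Const_def mult_single)
qed

lemma functional_combination:
  "functional g (\<Sum>(c, m) \<leftarrow> zip cs ms. Poly_Mapping.single m c) = (\<Sum>(c, m) \<leftarrow> zip cs ms. c * g m)"
  by (induction cs ms rule: list_induct2') (simp_all add: functional_zero functional_add functional_single)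

lemma homog_part_add:
  assumes "p \<in> homog_part V d" "q \<in> homog_part V d"
  shows "p + q \<in> homog_part V d"
  using assms keys_add[of p q] by (auto simp: homog_part_def add_in_poly_ring)

lemma single_in_homog_part:
  "m \<in> monomials_of_degree V d \<Longrightarrow> Poly_Mapping.single m c \<in> homog_part V d"
  by (auto simp: homog_part_def single_in_poly_ring monomials_of_degree_def)

lemma combination_in_homog_part:
  assumes "set ms \<subseteq> monomials_of_degree V d"
  shows "(\<Sum>(c, m) \<leftarrow> zip cs ms. Poly_Mapping.single m c) \<in> homog_part V d"
  using assms
proof (induction cs ms rule: list_induct2')
  case (4 c cs m ms)
  then show ?case by (simp add: homog_part_add single_in_homog_part)
qed (simp_all add: homog_part_def zero_in_poly_ring)

text \<open>One monomial from each fibre gives a basis of the degree-\<open>d\<close> component. It spans because monomials in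
  the same fibre agree modulo \<open>J\<close>; it is independent because the functional that sums the coefficients
  over one fibre vanishes on \<open>J\<close> and reads off the coefficient of the chosen monomial of that fibre.\<close>

theorem hilbert_function_eq_card_fibres:
  fixes J :: "('v, 'k::field) mpoly set" and \<phi> :: "'v monomial \<Rightarrow> 'w"
  assumes J: "ideal J (poly_ring V)" and null: "J \<subseteq> fibre_null V \<phi>"
    and fibre: "\<And>u v. u \<in> monomials_of_degree V d \<Longrightarrow> v \<in> monomials_of_degree V d \<Longrightarrow> \<phi> u = \<phi> v
      \<Longrightarrow> Poly_Mapping.single u 1 - Poly_Mapping.single v 1 \<in> J"
    and fin: "finite (\<phi> ` monomials_of_degree V d)"
  shows "hilbert_function V J d = card (\<phi> ` monomials_of_degree V d)"
proof -
  let ?R = "poly_ring V :: ('v, 'k) mpoly ring"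
  let ?Q = "?R Quot J"
  define \<pi> where "\<pi> = (\<lambda>p. J +>\<^bsub>?R\<^esub> p)"
  define X :: "'v monomial \<Rightarrow> ('v, 'k) mpoly" where "X = (\<lambda>m. Poly_Mapping.single m 1)"
  let ?K = "\<pi> ` range Const" and ?M = "monomials_of_degree V d"
  interpret R: cring ?R by (rule poly_ring_cring)
  interpret \<pi>: ring_hom_ring ?R ?Q \<pi>
    unfolding \<pi>_def by (rule ideal.rcos_ring_hom_ring[OF J])
  have \<pi>_eq: "\<pi> p = \<pi> q \<longleftrightarrow> p - q \<in> J" if "p \<in> carrier ?R" "q \<in> carrier ?R" for p q
    using R.quotient_eq_iff_same_a_r_cos[OF J that] poly_ring_minus[OF that] by (simp add: \<pi>_def)
  have \<pi>_zero: "p \<in> J" if "p \<in> carrier ?R" "\<pi> p = \<zero>\<^bsub>?Q\<^esub>" for p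
    using \<pi>_eq[OF that(1) zero_in_poly_ring] that \<pi>.hom_zero by (simp add: poly_ring_simps)
  have J0: "functional g p = 0" if "p \<in> J" "constant_on_fibres \<phi> g" for p g
    using null that unfolding fibre_null_def by blast
  have "functional (\<lambda>_. 1) (1 :: ('v, 'k) mpoly) = 1"
    by (simp flip: single_one add: functional_single)
  then have "(1 :: ('v, 'k) mpoly) \<notin> J"
    using J0[of 1 "\<lambda>_. 1"] by (auto simp: constant_on_fibres_def)
  then have "\<one>\<^bsub>?Q\<^esub> \<noteq> \<zero>\<^bsub>?Q\<^esub>"
    using \<pi>_zero[OF one_in_poly_ring] \<pi>.hom_one by (auto simp: poly_ring_simps)
  then have subfield: "subfield ?K ?Q"
    by (rule \<pi>.img_is_subfield(2)[OF Const_subfield])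

  \<comment> \<open>One monomial from each fibre; their classes will form a basis.\<close>
  obtain ws where ws: "set ws = \<phi> ` ?M" "distinct ws"
    using finite_distinct_list[OF fin] by blast
  define rep where "rep w = (SOME m. m \<in> ?M \<and> \<phi> m = w)" for w
  have rep: "rep w \<in> ?M" "\<phi> (rep w) = w" if "w \<in> \<phi> ` ?M" for w
    using someI_ex[of "\<lambda>m. m \<in> ?M \<and> \<phi> m = w"] that unfolding rep_def by blast+
  define ms where "ms = map rep ws"
  have ms_M: "set ms \<subseteq> ?M" using rep ws by (auto simp: ms_def)
  have \<phi>_ms: "map \<phi> ms = ws"
    unfolding ms_def using rep ws by (auto intro!: map_idI)
  have M_carrier: "Poly_Mapping.single m c \<in> carrier ?R" if "m \<in> ?M" for m c
    using that by (auto intro: single_in_poly_ring simp: monomials_of_degree_def)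
  let ?Us = "map \<pi> (map X ms)"
  have Xms: "set (map X ms) \<subseteq> carrier ?R"
    using ms_M M_carrier by (auto simp: X_def)
  then have Us: "set ?Us \<subseteq> carrier ?Q" by auto
  have comb: "\<pi>.S.combine (map \<pi> (map Const cs)) ?Us = \<pi> (\<Sum>(c, m) \<leftarrow> zip cs ms. Poly_Mapping.single m c)"
    for cs
  proof -
    have "set (map Const cs) \<subseteq> carrier ?R" by (auto simp: Const_in_poly_ring)
    from \<pi>.combine_hom[OF this Xms] show ?thesis
      using combine_Const_monomials[of V cs ms] by (simp add: X_def)
  qed
  have comb_carrier: "(\<Sum>(c, m) \<leftarrow> zip cs ms. Poly_Mapping.single m c) \<in> homog_part V d"
    for cs :: "'k list"
    using ms_M by (rule combination_in_homog_part)
  have coeffs: "\<exists>cs. Ks = map \<pi> (map Const cs)" if "set Ks \<subseteq> ?K" for Ks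
  proof -
    have "\<forall>k\<in>set Ks. \<exists>c. k = \<pi> (Const c)" using that by auto
    then obtain f where "\<forall>k\<in>set Ks. k = \<pi> (Const (f k))" by metis
    then have "Ks = map \<pi> (map Const (map f Ks))" by (simp add: map_idI)
    then show ?thesis by blast
  qed

  have indep: "\<pi>.S.independent ?K ?Us"
  proof (rule \<pi>.S.trivial_combine_imp_independent[OF subfield Us])
    fix Ks assume "set Ks \<subseteq> ?K" and 0: "\<pi>.S.combine Ks ?Us = \<zero>\<^bsub>?Q\<^esub>"
    then obtain cs where cs: "Ks = map \<pi> (map Const cs)" using coeffs by blast
    let ?p = "\<Sum>(c, m) \<leftarrow> zip cs ms. Poly_Mapping.single m c"
    have p: "?p \<in> J"
      using \<pi>_zero[of ?p] comb_carrier[of cs] comb[of cs] 0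
      by (simp add: cs homog_part_def)
    \<comment> \<open>The indicator of the fibre of the \<open>i\<close>-th chosen monomial isolates its coefficient.\<close>
    have zero: "cs ! i = 0" if i: "i < length cs" "i < length ms" for i
    proof -
      let ?g = "\<lambda>m. if \<phi> m = ws ! i then (1::'k) else 0"
      have len: "length ms = length ws" by (simp add: ms_def)
      have "0 = (\<Sum>(c, m) \<leftarrow> zip cs ms. c * ?g m)"
        using J0[OF p, of ?g] functional_combination[of ?g cs ms]
        by (simp add: constant_on_fibres_def)
      also have "\<dots> = (\<Sum>j < min (length cs) (length ms). cs ! j * ?g (ms ! j))"
        by (simp add: sum_list_sum_nth lessThan_atLeast0)
      also have "\<dots> = (\<Sum>j < min (length cs) (length ms). if j = i then cs ! i else 0)"
      proof (rule sum.cong[OF refl])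
        fix j assume j: "j \<in> {..<min (length cs) (length ms)}"
        then have "\<phi> (ms ! j) = ws ! j" using \<phi>_ms by (metis nth_map lessThan_iff min_less_iff_conj)
        moreover have "ws ! j = ws ! i \<longleftrightarrow> j = i"
          using j i len ws(2) by (simp add: nth_eq_iff_index_eq)
        ultimately show "cs ! j * ?g (ms ! j) = (if j = i then cs ! i else 0)" by auto
      qed
      also have "\<dots> = cs ! i" using i by simp
      finally show ?thesis by simp
    qed
    show "set (take (length ?Us) Ks) \<subseteq> {\<zero>\<^bsub>?Q\<^esub>}"
    proof
      fix k assume "k \<in> set (take (length ?Us) Ks)"
      then obtain i where "i < length cs" "i < length ms" "k = \<pi> (Const (cs ! i))"
        by (auto simp: cs in_set_conv_nth)
      then have "k = \<pi> 0" using zero by (simp add: Const_def)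
      then show "k \<in> {\<zero>\<^bsub>?Q\<^esub>}" using \<pi>.hom_zero by (simp add: poly_ring_simps)
    qed
  qed

  have span: "\<pi>.S.Span ?K ?Us = \<pi> ` homog_part V d"
  proof
    show "\<pi>.S.Span ?K ?Us \<subseteq> \<pi> ` homog_part V d"
    proof
      fix x assume "x \<in> \<pi>.S.Span ?K ?Us"
      then obtain Ks where Ks: "set Ks \<subseteq> ?K" "x = \<pi>.S.combine Ks ?Us"
        using \<pi>.S.Span_eq_combine_set[OF subfield Us] by blast
      from coeffs[OF Ks(1)] obtain cs where cs: "Ks = map \<pi> (map Const cs)" ..
      show "x \<in> \<pi> ` homog_part V d"
        unfolding Ks(2) cs comb by (rule imageI[OF comb_carrier])
    qed
  next
    have mono: "\<pi> (Poly_Mapping.single m c) \<in> \<pi>.S.Span ?K ?Us" if m: "m \<in> ?M" for m c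
    proof -
      have "rep (\<phi> m) \<in> set ms" using ws m by (simp add: ms_def)
      moreover have "\<pi> (X m) = \<pi> (X (rep (\<phi> m)))"
        using rep[of "\<phi> m"] m M_carrier fibre[of m "rep (\<phi> m)"] by (subst \<pi>_eq) (simp_all add: X_def)
      ultimately have "\<pi> (X m) \<in> set ?Us" by auto
      then have "\<pi> (X m) \<in> \<pi>.S.Span ?K ?Us"
        using \<pi>.S.Span_base_incl[OF subfield Us] by blast
      then have "\<pi> (Const c) \<otimes>\<^bsub>?Q\<^esub> \<pi> (X m) \<in> \<pi>.S.Span ?K ?Us"
        by (intro \<pi>.S.Span_smult_closed[OF subfield Us]) auto
      moreover have "\<pi> (Const c) \<otimes>\<^bsub>?Q\<^esub> \<pi> (X m) = \<pi> (Poly_Mapping.single m c)"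
        using \<pi>.hom_mult[OF Const_in_poly_ring M_carrier[OF m, of 1], of c]
        by (simp add: X_def poly_ring_simps Const_def mult_single)
      ultimately show ?thesis by simp
    qed
    show "\<pi> ` homog_part V d \<subseteq> \<pi>.S.Span ?K ?Us"
    proof
      fix x assume "x \<in> \<pi> ` homog_part V d"
      then obtain p where p: "p \<in> homog_part V d" "x = \<pi> p" by blast
      have keys: "Poly_Mapping.keys p \<subseteq> ?M"
        using p by (auto simp: homog_part_def carrier_poly_ring monomials_of_degree_def)
      have "\<pi> (\<Sum>m\<in>A. Poly_Mapping.single m (Poly_Mapping.lookup p m)) \<in> \<pi>.S.Span ?K ?Us \<and>
          (\<Sum>m\<in>A. Poly_Mapping.single m (Poly_Mapping.lookup p m)) \<in> carrier ?R"
        if "finite A" "A \<subseteq> ?M" for A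
        using that
      proof (induction A rule: finite_induct)
        case empty
        then show ?case
          using \<pi>.hom_zero \<pi>.S.Span_subgroup_props(2)[OF subfield Us]
          by (simp add: poly_ring_simps zero_in_poly_ring)
      next
        case (insert m A)
        then have "\<pi> (Poly_Mapping.single m (Poly_Mapping.lookup p m) +
              (\<Sum>m\<in>A. Poly_Mapping.single m (Poly_Mapping.lookup p m)))
            = \<pi> (Poly_Mapping.single m (Poly_Mapping.lookup p m)) \<oplus>\<^bsub>?Q\<^esub>
              \<pi> (\<Sum>m\<in>A. Poly_Mapping.single m (Poly_Mapping.lookup p m))"
          using \<pi>.hom_add[of "Poly_Mapping.single m (Poly_Mapping.lookup p m)"] M_carrier[of m]
          by (simp add: poly_ring_simps)
        then show ?case
          using insert mono[of m] \<pi>.S.Span_subgroup_props(3)[OF subfield Us]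
          by (simp add: M_carrier add_in_poly_ring)
      qed
      from this[OF finite_keys keys] show "x \<in> \<pi>.S.Span ?K ?Us"
        using p poly_mapping_eq_sum_singles[of p] by simp
    qed
  qed

  have "length ?Us = card (\<phi> ` ?M)"
    using ws distinct_card[of ws] by (simp add: ms_def)
  then have "\<pi>.S.dimension (card (\<phi> ` ?M)) ?K (\<pi> ` homog_part V d)"
    using \<pi>.S.dimension_independent[OF indep] span by simp
  then have "(\<pi>.S.dim over ?K) (\<pi> ` homog_part V d) = card (\<phi> ` ?M)"
    by (rule \<pi>.S.dimI[OF subfield])
  then show ?thesis
    by (simp add: hilbert_function_def \<pi>_def Let_def)
qed

section \<open>Monomials as multisets of variables\<close>

text \<open>Swaps act on products of variables taken one factor at a time, so the combinatorics is done on
  multisets and transported to exponent functions by this bijection.\<close>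

definition mon_of :: "'v multiset \<Rightarrow> 'v monomial" where
  "mon_of M = (\<Sum>v\<in>#M. Poly_Mapping.single v 1)"

definition mset_of :: "'v monomial \<Rightarrow> 'v multiset" where
  "mset_of m = Abs_multiset (Poly_Mapping.lookup m)"

lemma lookup_mon_of: "Poly_Mapping.lookup (mon_of M) v = count M v"
  by (induction M) (auto simp: mon_of_def lookup_add lookup_single)

lemma count_mset_of: "count (mset_of m) v = Poly_Mapping.lookup m v"
  unfolding mset_of_def by (subst count_Abs_multiset) auto

lemma mon_of_mset_of [simp]: "mon_of (mset_of m) = m"
  by (rule poly_mapping_eqI) (simp add: lookup_mon_of count_mset_of)

lemma mset_of_mon_of [simp]: "mset_of (mon_of M) = M"
  by (rule multiset_eqI) (simp add: lookup_mon_of count_mset_of)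

lemma mset_of_add: "mset_of (m + m') = mset_of m + mset_of m'"
  by (rule multiset_eqI) (simp add: count_mset_of lookup_add)

lemma mon_of_add: "mon_of (M + M') = mon_of M + mon_of M'"
  by (simp add: mon_of_def)

lemma set_mset_of: "set_mset (mset_of m) = Poly_Mapping.keys m"
  by (auto simp: count_mset_of in_keys_iff simp flip: count_greater_zero_iff)

lemma size_mset_of: "size (mset_of m) = mon_deg m"
  by (simp add: size_multiset_overloaded_eq set_mset_of count_mset_of mon_deg_def)

lemma monomials_of_degree_mset:
  "monomials_of_degree V d = mon_of ` {M. set_mset M \<subseteq> V \<and> size M = d}"
proof -
  have "m \<in> mon_of ` {M. set_mset M \<subseteq> V \<and> size M = d}" if "m \<in> monomials_of_degree V d" for m
    using that by (intro image_eqI[of _ _ "mset_of m"])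
      (auto simp: monomials_of_degree_def set_mset_of size_mset_of)
  moreover have "mon_of M \<in> monomials_of_degree V d" if "set_mset M \<subseteq> V" "size M = d" for M
    using that set_mset_of[of "mon_of M"] size_mset_of[of "mon_of M"]
    by (simp add: monomials_of_degree_def)
  ultimately show ?thesis by blast
qed

section \<open>Sums with bounded summands\<close>

lemma ex_bounded_summands:
  fixes r :: "'i \<Rightarrow> nat"
  assumes "finite I" "\<And>i. i \<in> I \<Longrightarrow> 1 \<le> r i" "card I \<le> h" "h \<le> sum r I"
  shows "\<exists>f. (\<forall>i\<in>I. f i \<in> {1..r i}) \<and> sum f I = h"
  using assms
proof (induction I arbitrary: h rule: finite_induct)
  case (insert i I)
  define v where "v = max 1 (h - sum r I)"
  have r: "1 \<le> r i" using insert.prems by simp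
  have cardle: "card I \<le> sum r I"
    using sum_mono[of I "\<lambda>_. 1" r] insert.prems(1) by simp
  have v: "1 \<le> v" "v \<le> r i" "v \<le> h" "card I \<le> h - v" "h - v \<le> sum r I"
    using insert.prems(2,3) insert.hyps r cardle by (auto simp: v_def max_def)
  obtain f where f: "\<forall>j\<in>I. f j \<in> {1..r j}" "sum f I = h - v"
    using insert.IH[of "h - v"] insert.prems(1) v by auto
  have "sum (f(i := v)) I = sum f I"
    using insert.hyps by (intro sum.cong) auto
  then show ?case
    using f v insert.hyps by (intro exI[of _ "f(i := v)"]) auto
qed auto

text \<open>Think of \<open>\<alpha> + x\<close> and \<open>\<beta> + y\<close> as two numbers split into a first coordinate, at most \<open>\<rho>\<close>, and a rest, at
  most \<open>T\<close>; exchanging the first coordinates connects the two pairs of numbers. Every pair can then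
  be balanced: if the numbers differ by at least two, some splitting yields an exchange that brings
  them strictly closer (\<open>step\<close>), and induction on their distance applies. If \<open>T = 0\<close> the exchange could only interchange
  the two numbers, so \<open>1 \<le> T\<close> is what makes progress possible.\<close>

lemma balance_pairs:
  fixes Q :: "nat \<times> nat \<Rightarrow> nat \<times> nat \<Rightarrow> bool"
  assumes Q: "equivp Q"
    and move: "\<And>\<alpha> \<beta> x y. \<alpha> \<le> \<rho> \<Longrightarrow> \<beta> \<le> \<rho> \<Longrightarrow> x \<le> T \<Longrightarrow> y \<le> T \<Longrightarrow> Q (\<alpha> + x, \<beta> + y) (\<beta> + x, \<alpha> + y)"
    and pos: "1 \<le> \<rho>" "1 \<le> T"
    and "k \<le> \<rho> + T" "l \<le> \<rho> + T"
  shows "Q (k, l) ((k + l) div 2, k + l - (k + l) div 2)"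
  using assms(5,6)
proof (induction "(k - l) + (l - k)" arbitrary: k l rule: less_induct)
  case less
  have step: "\<exists>\<alpha> \<beta> x y. \<alpha> \<le> \<rho> \<and> \<beta> \<le> \<rho> \<and> x \<le> T \<and> y \<le> T \<and> p = \<alpha> + x \<and> q = \<beta> + y \<and> \<alpha> < \<beta> \<and> \<beta> + p < \<alpha> + q"
    if "p + 2 \<le> q" "q \<le> \<rho> + T" for p q
    \<comment> \<open>Give \<open>p\<close> the smallest first coordinate for which its rest stays below \<open>T\<close>, and \<open>q\<close> the smallest one that is both larger and admissible; then the
      difference of the first coordinates is positive and less than \<open>q - p\<close>.\<close>
  proof (cases "q - T \<ge> (p + 1 - T) + 1")
    case True
    then show ?thesis
      using that pos by (intro exI[of _ "p + 1 - T"] exI[of _ "q - T"] exI[of _ "p - (p + 1 - T)"] exI[of _ T]) auto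
  next
    case False
    then show ?thesis
      using that pos by (intro exI[of _ "p + 1 - T"] exI[of _ "p + 1 - T + 1"]
          exI[of _ "p - (p + 1 - T)"] exI[of _ "q - (p + 1 - T + 1)"]) auto
  qed
  \<comment> \<open>The pair \<open>(l + 1, l)\<close> needs its own case: it is as close as possible, but not the chosen
    representative \<open>(l, l + 1)\<close>.\<close>
  consider "k + 2 \<le> l" | "l + 2 \<le> k" | "k = l + 1" | "k = l \<or> l = k + 1" by linarith
  then show ?case
  proof cases
    case 1
    then obtain \<alpha> \<beta> x y where *: "\<alpha> \<le> \<rho>" "\<beta> \<le> \<rho>" "x \<le> T" "y \<le> T" "k = \<alpha> + x" "l = \<beta> + y" "\<alpha> < \<beta>" "\<beta> + k < \<alpha> + l"
      using step less.prems by metis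
    then have "Q (\<beta> + x, \<alpha> + y) ((k + l) div 2, k + l - (k + l) div 2)"
      using less.hyps[of "\<beta> + x" "\<alpha> + y"] by (simp add: ac_simps)
    then show ?thesis using move[OF *(1-4)] *(5,6) equivp_transp[OF Q] by blast
  next
    case 2
    then obtain \<alpha> \<beta> x y where *: "\<alpha> \<le> \<rho>" "\<beta> \<le> \<rho>" "x \<le> T" "y \<le> T" "l = \<alpha> + x" "k = \<beta> + y" "\<alpha> < \<beta>" "\<beta> + l < \<alpha> + k"
      using step less.prems by metis
    then have "Q (\<alpha> + y, \<beta> + x) ((k + l) div 2, k + l - (k + l) div 2)"
      using less.hyps[of "\<alpha> + y" "\<beta> + x"] by (simp add: ac_simps)
    then show ?thesis using move[OF *(2,1,4,3)] *(5,6) equivp_transp[OF Q] by blast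
  next
    case 3
    have "Q ((l - min l T) + 1 + min l T, (l - min l T) + min l T) ((l - min l T) + min l T, (l - min l T) + 1 + min l T)"
      using less.prems pos 3 by (intro move) auto
    moreover have "(k + l) div 2 = l" "k + l - (k + l) div 2 = k" using 3 by auto
    ultimately show ?thesis using 3 by (simp add: min_def split: if_splits)
  next
    case 4
    then have "(k + l) div 2 = k" "k + l - (k + l) div 2 = l" by auto
    then show ?thesis using equivp_reflp[OF Q] by simp
  qed
qed

section \<open>Swaps connect the fibres of the tally map\<close>

text \<open>The setting of the theorem, with the assumption \<open>s \<ge> 2\<close> common to its two cases and without
  deciding between \<open>s \<le> t\<close> and \<open>t \<le> s\<close>.\<close>

locale partial_segre =
  fixes n s t :: nat and r :: "nat \<Rightarrow> nat"
  assumes r_ge: "\<And>i. i \<in> {1..n} \<Longrightarrow> 2 \<le> r i"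
    and s_ge: "2 \<le> s" and s_le: "s \<le> n" and t_ge: "1 \<le> t" and t_le: "t \<le> n"
begin

abbreviation "N \<equiv> index_set n r"

definition head :: "(nat \<Rightarrow> nat) \<Rightarrow> nat" where
  "head a = (\<Sum>i=1..s. a i)"

definition max_head :: nat where
  "max_head = (\<Sum>i=1..s. r i)"

definition same_tail :: "(nat \<Rightarrow> nat) \<Rightarrow> (nat \<Rightarrow> nat) \<Rightarrow> bool" where
  "same_tail a b \<longleftrightarrow> (\<forall>i\<in>{s+1..n}. a i = b i)"

text \<open>The positions after \<open>s\<close> are divided into blocks of coordinates that swaps cannot separate: the
  singletons \<open>{j}\<close> with \<open>s < j \<le> t\<close>, and block \<open>0\<close>, which holds the positions beyond both \<open>s\<close> and \<open>t\<close> and may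
  be empty. The label \<open>0\<close> is free because positions start at \<open>1\<close>.\<close>

definition block :: "nat \<Rightarrow> nat set" where
  "block j = (if j = 0 then {max s t + 1..n} else {j})"

definition blocks :: "nat set" where
  "blocks = insert 0 {s+1..t}"

text \<open>The complete invariant. The block components are restricted to the set of blocks so that equality
  of tallies is equality of functions and the set of tallies is a dependent product.\<close>

definition tally :: "(nat \<Rightarrow> nat) multiset \<Rightarrow> nat \<times> (nat \<Rightarrow> (nat \<Rightarrow> nat) multiset)" where
  "tally A = (\<Sum>a\<in>#A. head a, \<lambda>j\<in>blocks. image_mset (\<lambda>a. restrict a (block j)) A)"

text \<open>The congruence on monomials that the generators induce, expressed on multisets of indices: \<open>swap\<close>
  is a generator times a monomial, \<open>equiv\<close> reflects that equivalent indices name the same variable.\<close>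

inductive conn :: "(nat \<Rightarrow> nat) multiset \<Rightarrow> (nat \<Rightarrow> nat) multiset \<Rightarrow> bool" where
  swap: "a \<in> N \<Longrightarrow> b \<in> N \<Longrightarrow> i \<in> {1..t} \<Longrightarrow> set_mset C \<subseteq> N \<Longrightarrow>
    conn (add_mset a (add_mset b C)) (add_mset (sw i a b) (add_mset (sw i b a) C))"
| equiv: "(a, b) \<in> s_equiv n r s \<Longrightarrow> set_mset C \<subseteq> N \<Longrightarrow> conn (add_mset a C) (add_mset b C)"
| refl: "conn A A"
| sym: "conn A B \<Longrightarrow> conn B A"
| trans: "conn A B \<Longrightarrow> conn B C \<Longrightarrow> conn A C"

lemma tally_eq_iff:
  "tally A = tally B \<longleftrightarrow> (\<Sum>a\<in>#A. head a) = (\<Sum>a\<in>#B. head a) \<and>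
    (\<forall>j\<in>blocks. image_mset (\<lambda>a. restrict a (block j)) A = image_mset (\<lambda>a. restrict a (block j)) B)"
  by (auto simp: tally_def fun_eq_iff restrict_def)

lemma tally_union_cong: "tally A = tally B \<Longrightarrow> tally (C + A) = tally (C + B)"
  by (simp add: tally_eq_iff)

lemma tally_add_cancel: "tally (add_mset a A) = tally (add_mset a B) \<Longrightarrow> tally A = tally B"
  by (simp add: tally_eq_iff)

lemma tally_size: "tally A = tally B \<Longrightarrow> size A = size B"
  unfolding tally_eq_iff blocks_def by (metis insertI1 size_image_mset)

lemma s_equiv_iff: "(a, b) \<in> s_equiv n r s \<longleftrightarrow> a \<in> N \<and> b \<in> N \<and> head a = head b \<and> same_tail a b"
  by (simp add: s_equiv_def head_def same_tail_def)

lemma sw_in_N: "a \<in> N \<Longrightarrow> b \<in> N \<Longrightarrow> i \<in> {1..t} \<Longrightarrow> sw i a b \<in> N"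
  using t_le by (auto simp: index_set_def sw_def PiE_iff extensional_def)

lemma head_sw: "a \<in> N \<Longrightarrow> b \<in> N \<Longrightarrow> i \<in> {1..t} \<Longrightarrow> head (sw i a b) + head (sw i b a) = head a + head b"
proof (cases "i \<le> s")
  case True
  assume "i \<in> {1..t}"
  with True have i: "i \<in> {1..s}" by simp
  have "(\<Sum>j=1..s. (a(i := b i)) j) = b i + (\<Sum>j\<in>{1..s} - {i}. a j)" for a b :: "nat \<Rightarrow> nat"
    using i by (subst sum.remove[of _ i]) (auto intro!: sum.cong)
  moreover have "(\<Sum>j=1..s. a j) = a i + (\<Sum>j\<in>{1..s} - {i}. a j)" for a :: "nat \<Rightarrow> nat"
    using i by (subst sum.remove[of _ i]) auto
  ultimately show ?thesis unfolding head_def sw_def by simp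
next
  case False
  then have "head (sw i a b) = head a" "head (sw i b a) = head b"
    unfolding head_def sw_def by (auto intro!: sum.cong)
  then show ?thesis by simp
qed

lemma tally_swap:
  assumes "a \<in> N" "b \<in> N" "i \<in> {1..t}"
  shows "tally {#a, b#} = tally {#sw i a b, sw i b a#}"
  unfolding tally_eq_iff
proof (intro conjI ballI)
  show "(\<Sum>x\<in>#{#a, b#}. head x) = (\<Sum>x\<in>#{#sw i a b, sw i b a#}. head x)"
    using head_sw[OF assms] by simp
  fix j assume j: "j \<in> blocks"
  show "image_mset (\<lambda>x. restrict x (block j)) {#a, b#} = image_mset (\<lambda>x. restrict x (block j)) {#sw i a b, sw i b a#}"
  proof (cases "i \<in> block j")
    case True
    then have "block j = {i}" using j assms(3) by (auto simp: block_def blocks_def split: if_splits)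
    then have "restrict (sw i a b) (block j) = restrict b (block j)"
      "restrict (sw i b a) (block j) = restrict a (block j)"
      by (auto simp: sw_def restrict_def)
    then show ?thesis by simp
  next
    case False
    then have "restrict (sw i a b) (block j) = restrict a (block j)"
      "restrict (sw i b a) (block j) = restrict b (block j)"
      by (auto simp: sw_def restrict_def)
    then show ?thesis by simp
  qed
qed

lemma block_subset: "j \<in> blocks \<Longrightarrow> block j \<subseteq> {s+1..n}"
  using t_le by (auto simp: block_def blocks_def)

lemma tally_s_equiv:
  assumes "(a, b) \<in> s_equiv n r s"
  shows "tally {#a#} = tally {#b#}"
proof -
  have "restrict a (block j) = restrict b (block j)" if "j \<in> blocks" for j
    using assms block_subset[OF that] by (intro restrict_ext) (auto simp: s_equiv_iff same_tail_def)
  then show ?thesis using assms by (simp add: tally_eq_iff s_equiv_iff)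
qed

lemma conn_tally: "conn A B \<Longrightarrow> tally A = tally B"
proof (induction rule: conn.induct)
  case (swap a b i C)
  then show ?case using tally_union_cong[OF tally_swap[OF swap(1-3)], of C] by simp
next
  case (equiv a b C)
  then show ?case using tally_union_cong[OF tally_s_equiv[OF equiv(1)], of C] by simp
qed auto

lemma conn_in_N: "conn A B \<Longrightarrow> set_mset A \<subseteq> N \<longleftrightarrow> set_mset B \<subseteq> N"
proof (induction rule: conn.induct)
  case (swap a b i C)
  then show ?case using sw_in_N by auto
qed (auto simp: s_equiv_iff)

lemma head_bounds:
  assumes "a \<in> N" shows "s \<le> head a" "head a \<le> max_head"
proof -
  have "\<And>i. i \<in> {1..s} \<Longrightarrow> a i \<in> {1..r i}"
    using assms s_le by (auto simp: index_set_def PiE_iff)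
  then show "s \<le> head a" "head a \<le> max_head"
    using sum_mono[of "{1..s}" "\<lambda>_. 1" a] sum_mono[of "{1..s}" a r]
    by (auto simp: head_def max_head_def)
qed

text \<open>The first coordinate is prescribed separately because it is the one that \<open>conn_transfer\<close> swaps; position
  \<open>1\<close> can be swapped whatever the values of \<open>s\<close> and \<open>t\<close> are.\<close>

lemma ex_index_head_tail:
  assumes c: "c \<in> N" and v: "v \<in> {1..r 1}" and w: "s - 1 \<le> w" "w \<le> (\<Sum>i=2..s. r i)"
  shows "\<exists>a\<in>N. a 1 = v \<and> head a = v + w \<and> same_tail a c"
proof -
  have "1 \<le> r i" if "i \<in> {2..s}" for i
    using r_ge[of i] that s_le by simp
  then have "\<exists>f. (\<forall>i\<in>{2..s}. f i \<in> {1..r i}) \<and> sum f {2..s} = w"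
    using w by (intro ex_bounded_summands) auto
  then obtain f where f: "\<forall>i\<in>{2..s}. f i \<in> {1..r i}" "sum f {2..s} = w" by blast
  define a where "a = (\<lambda>i. if i = 1 then v else if i \<in> {2..s} then f i else c i)"
  have "a \<in> N"
    using c v f s_le s_ge by (auto simp: index_set_def PiE_iff extensional_def a_def)
  moreover have "{1..s} = insert 1 {2..s}" using s_ge by auto
  then have "head a = v + w"
    using f by (simp add: head_def a_def)
  moreover have "same_tail a c" using s_ge by (simp add: same_tail_def a_def)
  moreover have "a 1 = v" by (simp add: a_def)
  ultimately show ?thesis by blast
qed

lemma max_head_split: "max_head = r 1 + (\<Sum>i=2..s. r i)" "s \<le> (\<Sum>i=2..s. r i)"
proof -
  have "{1..s} = insert 1 {2..s}" using s_ge by auto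
  then show "max_head = r 1 + (\<Sum>i=2..s. r i)" by (simp add: max_head_def)
  have "2 * (s - 1) \<le> (\<Sum>i=2..s. r i)"
    using sum_mono[of "{2..s}" "\<lambda>_. 2" r] r_ge s_le by auto
  then show "s \<le> (\<Sum>i=2..s. r i)" using s_ge by linarith
qed

lemma ex_index_head:
  assumes "c \<in> N" "s \<le> h" "h \<le> max_head"
  shows "\<exists>a\<in>N. head a = h \<and> same_tail a c"
proof -
  have r1: "2 \<le> r 1" using r_ge s_ge s_le by simp
  define w where "w = min (h - 1) (\<Sum>i=2..s. r i)"
  have "s - 1 \<le> w" "w \<le> (\<Sum>i=2..s. r i)" "h - w \<in> {1..r 1}" "h - w + w = h"
    using assms(2,3) max_head_split s_ge r1 by (auto simp: w_def)
  then show ?thesis using ex_index_head_tail[OF assms(1)] by metis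
qed

lemma same_tail_refl: "same_tail a a" by (simp add: same_tail_def)
lemma same_tail_sym: "same_tail a b \<Longrightarrow> same_tail b a" by (simp add: same_tail_def)
lemma same_tail_trans: "same_tail a b \<Longrightarrow> same_tail b c \<Longrightarrow> same_tail a c" by (simp add: same_tail_def)

text \<open>Two members of a multiset may exchange head units freely while each keeps its tail. Up to
  \<open>s\<close>-equivalence an index is determined by its tail and its head, so both pairs can be represented
  by the shifted heads \<open>head a - s\<close> and \<open>head b - s\<close>, and \<open>balance_pairs\<close> connects both
  of them to the same balanced pair. The shift by \<open>s\<close> makes \<open>0\<close> the least value.\<close>

lemma conn_transfer:
  assumes N: "a \<in> N" "b \<in> N" "a' \<in> N" "b' \<in> N" "set_mset C \<subseteq> N"
    and tail: "same_tail a a'" "same_tail b b'"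
    and head: "head a + head b = head a' + head b'"
  shows "conn (add_mset a (add_mset b C)) (add_mset a' (add_mset b' C))"
proof -
  define T where "T = (\<Sum>i=2..s. r i) - (s - 1)"
  define \<rho> where "\<rho> = r 1 - 1"
  have r1: "2 \<le> r 1" using r_ge s_ge s_le by simp
  have bound: "\<rho> + T + s = max_head"
    using max_head_split r1 s_ge by (simp add: T_def \<rho>_def)
  \<comment> \<open>A representative of the variable with the tail of \<open>c\<close> and shifted head \<open>k\<close>.\<close>
  define nf where "nf c k = (SOME x. x \<in> N \<and> head x = s + k \<and> same_tail x c)" for c k
  have nf: "nf c k \<in> N" "head (nf c k) = s + k" "same_tail (nf c k) c" if "c \<in> N" "k \<le> \<rho> + T" for c k
  proof -
    have "\<exists>x. x \<in> N \<and> head x = s + k \<and> same_tail x c"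
      using ex_index_head[of c "s + k"] that bound by auto
    from someI_ex[OF this] show "nf c k \<in> N" "head (nf c k) = s + k" "same_tail (nf c k) c"
      unfolding nf_def by blast+
  qed
  have normal: "conn (add_mset x (add_mset y C)) (add_mset (nf a (head x - s)) (add_mset (nf b (head y - s)) C))"
    if "x \<in> N" "y \<in> N" "same_tail x a" "same_tail y b" for x y
  proof -
    have nf_equiv: "(z, nf c (head z - s)) \<in> s_equiv n r s"
      if z: "z \<in> N" "c \<in> N" "same_tail z c" for z c
    proof -
      have le: "head z - s \<le> \<rho> + T" using head_bounds[OF z(1)] bound by simp
      have "same_tail z (nf c (head z - s))"
        using z(3) nf(3)[OF z(2) le] same_tail_trans same_tail_sym by blast
      then show ?thesis
        using nf(1,2)[OF z(2) le] z head_bounds[OF z(1)] by (simp add: s_equiv_iff)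
    qed
    have x: "(x, nf a (head x - s)) \<in> s_equiv n r s" and y: "(y, nf b (head y - s)) \<in> s_equiv n r s"
      using nf_equiv that N by auto
    have "conn (add_mset x (add_mset y C)) (add_mset (nf a (head x - s)) (add_mset y C))"
      using x that N by (intro conn.equiv) auto
    moreover have "conn (add_mset (nf a (head x - s)) (add_mset y C))
        (add_mset (nf a (head x - s)) (add_mset (nf b (head y - s)) C))"
      using x y that N by (subst (1 2) add_mset_commute, intro conn.equiv) (auto simp: s_equiv_iff)
    ultimately show ?thesis by (rule conn.trans)
  qed
  define Q where "Q = (\<lambda>(k, l) (k', l').
    conn (add_mset (nf a k) (add_mset (nf b l) C)) (add_mset (nf a k') (add_mset (nf b l') C)))"
  have Q: "equivp Q"
    by (rule equivpI) (auto simp: Q_def reflp_def symp_def transp_def intro: conn.refl conn.sym conn.trans)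
  have move: "Q (\<alpha> + x, \<beta> + y) (\<beta> + x, \<alpha> + y)"
    if *: "\<alpha> \<le> \<rho>" "\<beta> \<le> \<rho>" "x \<le> T" "y \<le> T" for \<alpha> \<beta> x y
  proof -
    have bounds: "z + 1 \<in> {1..r 1}" "s - 1 \<le> u + (s - 1)" "u + (s - 1) \<le> (\<Sum>i=2..s. r i)"
      if "z \<le> \<rho>" "u \<le> T" for z u
      using that r1 max_head_split s_ge by (auto simp: \<rho>_def T_def)
    obtain p where p: "p \<in> N" "p 1 = \<alpha> + 1" "head p = (\<alpha> + 1) + (x + (s - 1))" "same_tail p a"
      using ex_index_head_tail[OF N(1) bounds[OF *(1,3)]] by blast
    obtain q where q: "q \<in> N" "q 1 = \<beta> + 1" "head q = (\<beta> + 1) + (y + (s - 1))" "same_tail q b"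
      using ex_index_head_tail[OF N(2) bounds[OF *(2,4)]] by blast
    have hd: "head (sw 1 u v) + u 1 = head u + v 1" for u v
    proof -
      have "{1..s} = insert 1 {2..s}" using s_ge by auto
      then show ?thesis by (simp add: head_def sw_def)
    qed
    have st: "same_tail (sw 1 u v) c" if "same_tail u c" for u v c
      using that s_ge by (simp add: same_tail_def sw_def)
    have "conn (add_mset p (add_mset q C)) (add_mset (sw 1 p q) (add_mset (sw 1 q p) C))"
      using p q N t_ge by (intro conn.swap) auto
    moreover have "conn (add_mset p (add_mset q C)) (add_mset (nf a (\<alpha> + x)) (add_mset (nf b (\<beta> + y)) C))"
      using normal[of p q] p q s_ge by simp
    moreover have "head (sw 1 p q) = s + (\<beta> + x)" "head (sw 1 q p) = s + (\<alpha> + y)"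
      using hd[of p q] hd[of q p] p q s_ge by auto
    then have "conn (add_mset (sw 1 p q) (add_mset (sw 1 q p) C)) (add_mset (nf a (\<beta> + x)) (add_mset (nf b (\<alpha> + y)) C))"
      using normal[of "sw 1 p q" "sw 1 q p"] p q st[of p a q] st[of q b p] sw_in_N[of _ _ 1] t_ge by simp
    ultimately have "conn (add_mset (nf a (\<alpha> + x)) (add_mset (nf b (\<beta> + y)) C))
        (add_mset (nf a (\<beta> + x)) (add_mset (nf b (\<alpha> + y)) C))"
      using conn.sym conn.trans by blast
    then show ?thesis by (simp add: Q_def)
  qed
  have pos: "1 \<le> \<rho>" "1 \<le> T" using r1 max_head_split s_ge by (auto simp: \<rho>_def T_def)
  let ?k = "head a - s" and ?l = "head b - s" and ?k' = "head a' - s" and ?l' = "head b' - s"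
  have le_T: "head z - s \<le> \<rho> + T" if "z \<in> N" for z
    using head_bounds(2)[OF that] bound by linarith
  have sum_eq: "?k + ?l = ?k' + ?l'"
  proof -
    have shift: "head z = s + (head z - s)" if "z \<in> N" for z
      using head_bounds(1)[OF that] by simp
    have "s + ?k + (s + ?l) = s + ?k' + (s + ?l')"
      using head unfolding shift[OF N(1), symmetric] shift[OF N(2), symmetric] shift[OF N(3), symmetric] shift[OF N(4), symmetric] .
    then show ?thesis by simp
  qed
  note le = le_T[OF N(1)] le_T[OF N(2)] le_T[OF N(3)] le_T[OF N(4)] sum_eq
  have balanced: "Q (k, l) ((k + l) div 2, k + l - (k + l) div 2)" if "k \<le> \<rho> + T" "l \<le> \<rho> + T" for k l
    by (rule balance_pairs[where Q = Q and \<rho> = \<rho> and T = T]) (fact Q move pos that)+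
  have "Q (?k, ?l) (?k', ?l')"
  proof -
    have Qsym: "Q v u" if "Q u v" for u v using equivp_symp[OF Q that] .
    have Qtrans: "Q u w" if "Q u v" "Q v w" for u v w using equivp_transp[OF Q that] .
    have "Q (?k', ?l') ((?k + ?l) div 2, ?k + ?l - (?k + ?l) div 2)"
      unfolding sum_eq by (rule balanced[OF le(3,4)])
    from Qtrans[OF balanced[OF le(1,2)] Qsym[OF this]] show ?thesis .
  qed
  then have mid: "conn (add_mset (nf a ?k) (add_mset (nf b ?l) C))
      (add_mset (nf a ?k') (add_mset (nf b ?l') C))"
    by (simp add: Q_def)
  show ?thesis
    by (rule conn.trans[OF normal[OF N(1,2) same_tail_refl same_tail_refl] conn.trans[OF mid]])
      (rule conn.sym[OF normal[OF N(3,4) tail[THEN same_tail_sym]]])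
qed

lemma sum_head_bounds:
  assumes "set_mset A \<subseteq> N"
  shows "s * size A \<le> (\<Sum>a\<in>#A. head a)" "(\<Sum>a\<in>#A. head a) \<le> max_head * size A"
  using assms head_bounds by (induction A) (fastforce intro: add_mono)+

text \<open>As long as the head of \<open>a\<close> is too small, some other member has a head above the minimum \<open>s\<close>:
  otherwise the total would be less than the total of the target, which has the same size. That
  member gives one unit to \<open>a\<close>. The case of too large a head is symmetric, with the maximum in place of
  the minimum.\<close>

lemma conn_match_head:
  assumes "a \<in> N" "b \<in> N" "same_tail a b" "set_mset A \<subseteq> N" "set_mset B \<subseteq> N"
    and "tally (add_mset a A) = tally (add_mset b B)"
  shows "\<exists>A'. conn (add_mset a A) (add_mset b A')"
  using assms
proof (induction "(head a - head b) + (head b - head a)" arbitrary: a A rule: less_induct)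
  case less
  have sums: "head a + (\<Sum>x\<in>#A. head x) = head b + (\<Sum>x\<in>#B. head x)"
    using less.prems(6) by (simp add: tally_eq_iff)
  have size: "size A = size B" using tally_size[OF less.prems(6)] by simp
  have B: "s * size A \<le> (\<Sum>x\<in>#B. head x)" "(\<Sum>x\<in>#B. head x) \<le> max_head * size A"
    using sum_head_bounds[OF less.prems(5)] size by auto
  have step: ?case
    if x: "x \<in># A" and h: "s \<le> h" "h \<le> max_head" "s \<le> h'" "h' \<le> max_head" "h + h' = head a + head x"
      and dec: "(h - head b) + (head b - h) < (head a - head b) + (head b - head a)" for x h h'
  proof -
    obtain A0 where A: "A = add_mset x A0" using x by (metis multi_member_split)
    have xN: "x \<in> N" "set_mset A0 \<subseteq> N" using less.prems A by auto
    obtain a' where a': "a' \<in> N" "head a' = h" "same_tail a' a"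
      using ex_index_head[OF less.prems(1) h(1,2)] by blast
    obtain x' where x': "x' \<in> N" "head x' = h'" "same_tail x' x"
      using ex_index_head[OF xN(1) h(3,4)] by blast
    have c: "conn (add_mset a A) (add_mset a' (add_mset x' A0))"
      unfolding A using less.prems a' x' xN h same_tail_sym by (intro conn_transfer) auto
    have "\<exists>A'. conn (add_mset a' (add_mset x' A0)) (add_mset b A')"
      using conn_tally[OF c] dec a' x' xN less.prems same_tail_trans[OF a'(3) less.prems(3)]
      by (intro less.hyps) auto
    then show ?thesis using conn.trans[OF c] by blast
  qed
  consider "head a = head b" | "head a < head b" | "head b < head a" by linarith
  then show ?case
  proof cases
    case 1
    then have "conn (add_mset a A) (add_mset b A)"
      using less.prems by (intro conn.equiv) (auto simp: s_equiv_iff)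
    then show ?thesis by blast
  next
    case 2
    have "\<exists>x\<in>#A. s < head x"
    proof (rule ccontr)
      assume "\<not> ?thesis"
      then have "(\<Sum>x\<in>#A. head x) \<le> (\<Sum>x\<in>#A. s)" by (intro sum_mset_mono) auto
      then show False using 2 sums B by (simp add: mult.commute)
    qed
    then obtain x where x: "x \<in># A" "s < head x" by blast
    show ?thesis
      using 2 x head_bounds[of a] head_bounds[of b] head_bounds[of x] less.prems
      by (intro step[of x "head a + 1" "head x - 1"]) auto
  next
    case 3
    have "\<exists>x\<in>#A. head x < max_head"
    proof (rule ccontr)
      assume "\<not> ?thesis"
      then have "(\<Sum>x\<in>#A. max_head) \<le> (\<Sum>x\<in>#A. head x)" by (intro sum_mset_mono) auto
      then show False using 3 sums B by (simp add: mult.commute)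
    qed
    then obtain x where x: "x \<in># A" "head x < max_head" by blast
    show ?thesis
      using 3 x head_bounds[of a] head_bounds[of b] head_bounds[of x] less.prems
      by (intro step[of x "head a - 1" "head x + 1"]) auto
  qed
qed

lemma tally_block_member:
  assumes "tally A = tally (add_mset b B)" "j \<in> blocks"
  shows "\<exists>a\<in>#A. restrict a (block j) = restrict b (block j)"
proof -
  have "restrict b (block j) \<in># image_mset (\<lambda>a. restrict a (block j)) (add_mset b B)" by simp
  then have "restrict b (block j) \<in># image_mset (\<lambda>a. restrict a (block j)) A"
    using assms by (simp add: tally_eq_iff)
  then show ?thesis by auto
qed

text \<open>The block beyond \<open>s\<close> and \<open>t\<close> cannot be changed by swaps, so a member that already agrees with \<open>b\<close>
  there is the starting point. The other coordinates are corrected one by one: the tally guarantees a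
  member with the required coordinate, which is swapped in without disturbing the rest.\<close>

lemma conn_match_coordinates:
  assumes "finite I" "I \<subseteq> {s+1..t}" "set_mset A \<subseteq> N" "tally A = tally (add_mset b B)"
  shows "\<exists>a A'. conn A (add_mset a A') \<and> restrict a (block 0) = restrict b (block 0) \<and> (\<forall>i\<in>I. a i = b i)"
  using assms
proof (induction I rule: finite_induct)
  case empty
  obtain a where "a \<in># A" "restrict a (block 0) = restrict b (block 0)"
    using tally_block_member[OF empty(3), of 0] by (auto simp: blocks_def)
  then show ?case by (metis conn.refl empty_iff multi_member_split)
next
  case (insert i I)
  then have "I \<subseteq> {s+1..t}" by simp
  from insert.IH[OF this insert.prems(2,3)] obtain a A'
    where a: "conn A (add_mset a A')" "restrict a (block 0) = restrict b (block 0)" "\<forall>i\<in>I. a i = b i"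
    by blast
  have N: "a \<in> N" "set_mset A' \<subseteq> N" using conn_in_N[OF a(1)] insert.prems by auto
  have i: "i \<in> blocks" "block i = {i}" "i \<notin> block 0" "i \<in> {1..t}"
    using insert.prems(1) by (auto simp: blocks_def block_def)
  obtain x where x: "x \<in># add_mset a A'" "x i = b i"
    using tally_block_member[of "add_mset a A'" b B i] conn_tally[OF a(1)] insert.prems i
    by (auto simp: restrict_def fun_eq_iff split: if_splits)
  show ?case
  proof (cases "x = a")
    case True
    then show ?thesis using a x by blast
  next
    case False
    then obtain A0 where A': "A' = add_mset x A0" using x by (auto dest: multi_member_split)
    have "conn (add_mset a A') (add_mset (sw i a x) (add_mset (sw i x a) A0))"
      unfolding A' using N A' i by (intro conn.swap) auto
    moreover have "restrict (sw i a x) (block 0) = restrict b (block 0)"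
    proof -
      have "restrict (sw i a x) (block 0) = restrict a (block 0)"
        using i(3) by (intro restrict_ext) (auto simp: sw_def)
      then show ?thesis using a(2) by simp
    qed
    moreover have "\<forall>j\<in>insert i I. sw i a x j = b j"
      using a(3) x(2) by (simp add: sw_def)
    ultimately show ?thesis using conn.trans[OF a(1)] by blast
  qed
qed

lemma same_tail_iff_blocks:
  "same_tail a b \<longleftrightarrow> restrict a (block 0) = restrict b (block 0) \<and> (\<forall>i\<in>{s+1..t}. a i = b i)"
proof -
  have "{s+1..n} = {max s t + 1..n} \<union> {s+1..t}" using t_le by auto
  then show ?thesis
    by (auto simp: same_tail_def block_def restrict_def fun_eq_iff)
qed

lemma conn_add_mset: "conn A B \<Longrightarrow> c \<in> N \<Longrightarrow> conn (add_mset c A) (add_mset c B)"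
proof (induction rule: conn.induct)
  case (swap a b i C)
  then show ?case using conn.swap[of a b i "add_mset c C"] by (simp add: add_mset_commute)
next
  case (equiv a b C)
  then show ?case using conn.equiv[of a b "add_mset c C"] by (simp add: add_mset_commute)
qed (auto intro: conn.refl conn.sym conn.trans)

text \<open>The tally is a complete invariant: by induction on the target, each of its members is produced
  from the source and then cancelled on both sides.\<close>

theorem fibres_connected:
  assumes "set_mset A \<subseteq> N" "set_mset B \<subseteq> N" "tally A = tally B"
  shows "conn A B"
  using assms
proof (induction B arbitrary: A)
  case empty
  then show ?case using tally_size[of A "{#}"] conn.refl by simp
next
  case (add b B)
  obtain a A1 where A1: "conn A (add_mset a A1)" "same_tail a b"
    using conn_match_coordinates[of "{s+1..t}" A b B] add.prems same_tail_iff_blocks by blast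
  have N1: "a \<in> N" "set_mset A1 \<subseteq> N" using conn_in_N[OF A1(1)] add.prems by auto
  have t1: "tally (add_mset a A1) = tally (add_mset b B)"
    using conn_tally[OF A1(1)] add.prems by simp
  obtain A2 where A2: "conn (add_mset a A1) (add_mset b A2)"
    using conn_match_head[OF N1(1) _ A1(2) N1(2) _ t1] add.prems by auto
  have "set_mset A2 \<subseteq> N" using conn_in_N[OF A2] N1 by auto
  moreover have "tally A2 = tally B"
    using conn_tally[OF A2] t1 tally_add_cancel by metis
  ultimately have "conn (add_mset b A2) (add_mset b B)"
    using add by (intro conn_add_mset add.IH) auto
  then show ?case using A1 A2 conn.trans by blast
qed

end

context partial_segre
begin

section \<open>Counting the fibres\<close>

lemma restrict_block_in:
  assumes "a \<in> N" "j \<in> blocks"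
  shows "restrict a (block j) \<in> (\<Pi>\<^sub>E i\<in>block j. {1..r i})"
proof -
  have "a i \<in> {1..r i}" if "i \<in> block j" for i
    using assms(1) block_subset[OF assms(2)] that s_ge by (auto simp: index_set_def PiE_iff)
  then show ?thesis by (simp add: PiE_iff)
qed

definition tallies :: "nat \<Rightarrow> (nat \<times> (nat \<Rightarrow> (nat \<Rightarrow> nat) multiset)) set" where
  "tallies d = {s * d..max_head * d} \<times>
     (\<Pi>\<^sub>E j\<in>blocks. multisets_of_size (\<Pi>\<^sub>E i\<in>block j. {1..r i}) d)"

lemma tally_in_tallies:
  assumes "set_mset A \<subseteq> N"
  shows "tally A \<in> tallies (size A)"
proof -
  have "(\<lambda>a. restrict a (block j)) ` set_mset A \<subseteq> (\<Pi>\<^sub>E i\<in>block j. {1..r i})" if "j \<in> blocks" for j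
    using assms restrict_block_in[OF _ that] by blast
  then have "image_mset (\<lambda>a. restrict a (block j)) A \<in> multisets_of_size (\<Pi>\<^sub>E i\<in>block j. {1..r i}) (size A)"
    if "j \<in> blocks" for j
    using that by (simp add: multisets_of_size_def)
  then show ?thesis
    using sum_head_bounds[OF assms] unfolding tally_def tallies_def
    by (intro SigmaI restrict_PiE_iff[THEN iffD2] ballI) simp_all
qed

text \<open>Head and block entries of an index can be prescribed independently, because the blocks are
  disjoint and lie after the first \<open>s\<close> positions.\<close>

lemma ex_index_blocks:
  assumes e: "\<And>j. j \<in> blocks \<Longrightarrow> e j \<in> (\<Pi>\<^sub>E i\<in>block j. {1..r i})" and "s \<le> h" "h \<le> max_head"
  shows "\<exists>a\<in>N. head a = h \<and> (\<forall>j\<in>blocks. restrict a (block j) = e j)"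
proof -
  define c where "c = (\<lambda>i. if i \<in> {1..s} then 1 else if i \<in> {s+1..n} then e (if i \<le> t then i else 0) i else undefined)"
  have cin: "c i \<in> {1..r i}" if i: "i \<in> {1..n}" for i
  proof (cases "i \<le> s")
    case True
    then show ?thesis using i r_ge[OF i] by (simp add: c_def)
  next
    case False
    let ?j = "if i \<le> t then i else 0"
    have "?j \<in> blocks" "i \<in> block ?j" using False i by (auto simp: blocks_def block_def)
    then show ?thesis using e[of ?j] False i by (auto simp: c_def PiE_iff)
  qed
  have "c i = undefined" if "i \<notin> {1..n}" for i
    using that s_le by (auto simp: c_def)
  with cin have "c \<in> N" by (auto simp: index_set_def PiE_iff extensional_def)
  then obtain a where a: "a \<in> N" "head a = h" "same_tail a c"
    using ex_index_head assms(2,3) by blast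
  have "restrict a (block j) = e j" if j: "j \<in> blocks" for j
  proof
    fix i
    show "restrict a (block j) i = e j i"
    proof (cases "i \<in> block j")
      case True
      then have i: "i \<in> {s+1..n}" using block_subset[OF j] by blast
      then have "a i = c i" using a(3) by (auto simp: same_tail_def)
      also have "\<dots> = e (if i \<le> t then i else 0) i" using i by (simp add: c_def)
      also have "(if i \<le> t then i else 0) = j"
        using j True i by (auto simp: blocks_def block_def split: if_splits)
      finally show ?thesis using True by simp
    next
      case False
      then show ?thesis using PiE_arb[OF e[OF j] False] by simp
    qed
  qed
  then show ?thesis using a by blast
qed

text \<open>The members are split off one at a time: an arbitrary element of each block multiset is removed, and
  the head of the new member is chosen so that the remaining total can still be
  reached by \<open>d\<close> heads.\<close>

lemma tallies_attained:
  assumes "(h, F) \<in> tallies d"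
  shows "\<exists>A. set_mset A \<subseteq> N \<and> size A = d \<and> tally A = (h, F)"
  using assms
proof (induction d arbitrary: h F)
  case 0
  then have "h = 0" "F = (\<lambda>j\<in>blocks. {#})"
    by (auto simp: tallies_def multisets_of_size_def PiE_iff extensional_def)
  then show ?case by (intro exI[of _ "{#}"]) (simp add: tally_def restrict_def)
next
  case (Suc d)
  have h: "s * Suc d \<le> h" "h \<le> max_head * Suc d"
    and F: "F \<in> (\<Pi>\<^sub>E j\<in>blocks. multisets_of_size (\<Pi>\<^sub>E i\<in>block j. {1..r i}) (Suc d))"
    using Suc.prems by (auto simp: tallies_def)
  have Fj: "set_mset (F j) \<subseteq> (\<Pi>\<^sub>E i\<in>block j. {1..r i})" "size (F j) = Suc d" if "j \<in> blocks" for j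
    using PiE_mem[OF F that] by (auto simp: multisets_of_size_def)
  have "\<exists>e. e \<in># F j" if "j \<in> blocks" for j
    using Fj(2)[OF that] by (metis multiset_nonemptyE size_empty Zero_not_Suc)
  then obtain e where e: "\<And>j. j \<in> blocks \<Longrightarrow> e j \<in># F j" by metis
  \<comment> \<open>The least head that leaves at most \<open>max_head * d\<close> for the other \<open>d\<close> members.\<close>
  define k where "k = max s (h - max_head * d)"
  have "s \<le> max_head" using max_head_split by linarith
  then have k: "s \<le> k" "k \<le> max_head" "s * d \<le> h - k" "h - k \<le> max_head * d" "k \<le> h"
  proof -
    have "s * d \<le> max_head * d" by (rule mult_le_mono1) fact
    then show "s \<le> k" "k \<le> max_head" "s * d \<le> h - k" "h - k \<le> max_head * d" "k \<le> h"
      using h \<open>s \<le> max_head\<close> unfolding k_def mult_Suc_right by linarith+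
  qed
  obtain a where a: "a \<in> N" "head a = k" "\<And>j. j \<in> blocks \<Longrightarrow> restrict a (block j) = e j"
    using ex_index_blocks[OF _ k(1,2), of e] Fj(1) e by blast
  have "F j - {#e j#} \<in> multisets_of_size (\<Pi>\<^sub>E i\<in>block j. {1..r i}) d" if "j \<in> blocks" for j
    using Fj[OF that] e[OF that] unfolding multisets_of_size_def
    by (simp add: size_Diff_singleton) (blast dest: in_diffD)
  then have "(h - k, \<lambda>j\<in>blocks. F j - {#e j#}) \<in> tallies d"
    using k(3,4) by (simp add: tallies_def)
  then obtain A where A: "set_mset A \<subseteq> N" "size A = d" "tally A = (h - k, \<lambda>j\<in>blocks. F j - {#e j#})"
    using Suc.IH by blast
  have sumA: "(\<Sum>x\<in>#A. head x) = h - k" using A(3) by (simp add: tally_def)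
  have "image_mset (\<lambda>x. restrict x (block j)) A = F j - {#e j#}" if "j \<in> blocks" for j
  proof -
    have "(\<lambda>j\<in>blocks. image_mset (\<lambda>x. restrict x (block j)) A) = (\<lambda>j\<in>blocks. F j - {#e j#})"
      using A(3) by (simp add: tally_def)
    from fun_cong[OF this, of j] that show ?thesis by simp
  qed
  then have "image_mset (\<lambda>x. restrict x (block j)) (add_mset a A) = F j" if "j \<in> blocks" for j
    using that a(3)[OF that] e[OF that] by simp
  then have "(\<lambda>j\<in>blocks. image_mset (\<lambda>x. restrict x (block j)) (add_mset a A)) = F"
    using PiE_arb[OF F] by (intro ext) auto
  then have "tally (add_mset a A) = (h, F)"
    using sumA a(2) k(5) by (simp add: tally_def)
  then show ?case using A a by (intro exI[of _ "add_mset a A"]) auto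
qed

lemma tally_image: "tally ` {A. set_mset A \<subseteq> N \<and> size A = d} = tallies d"
proof
  show "tally ` {A. set_mset A \<subseteq> N \<and> size A = d} \<subseteq> tallies d"
    using tally_in_tallies by blast
  show "tallies d \<subseteq> tally ` {A. set_mset A \<subseteq> N \<and> size A = d}"
    using tallies_attained by (auto simp: image_iff) metis
qed

lemma finite_block: "finite (block j)"
  by (simp add: block_def)

lemma finite_tallies: "finite (tallies d)"
  unfolding tallies_def
  by (intro finite_cartesian_product finite_PiE finite_multisets_of_size finite_block)
    (simp_all add: blocks_def)

lemma card_tallies:
  "card (tallies d) = (d * (\<Sum>j=1..s. (r j - 1)) + 1)
     * ((d + (\<Prod>j=max s t + 1..n. r j) - 1) choose d)
     * (\<Prod>i=s+1..t. ((d + r i - 1) choose d))"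
proof -
  have r1: "1 \<le> r j" if "j \<in> {1..s}" for j
    using r_ge[of j] that s_le by simp
  have "(\<Sum>j=1..s. (r j - 1)) = max_head - s"
    using sum_subtractf_nat[of "{1..s}" "\<lambda>_. 1" r] r1 by (simp add: max_head_def)
  then have 1: "card {s * d..max_head * d} = d * (\<Sum>j=1..s. (r j - 1)) + 1"
  proof -
    have "s \<le> max_head" using max_head_split by linarith
    then have "d * s \<le> d * max_head" by simp
    then show ?thesis
      unfolding \<open>(\<Sum>j=1..s. (r j - 1)) = max_head - s\<close> card_atLeastAtMost
        diff_mult_distrib2 mult.commute[of _ d] by linarith
  qed
  have card_block: "card (\<Pi>\<^sub>E i\<in>block j. {1..r i}) = (\<Prod>i\<in>block j. r i)" for j
    by (simp add: card_PiE finite_block)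
  have "card (multisets_of_size (\<Pi>\<^sub>E i\<in>block j. {1..r i}) d) = (d + (\<Prod>i\<in>block j. r i) - 1) choose d" for j
  proof -
    have "finite (\<Pi>\<^sub>E i\<in>block j. {1..r i})" by (simp add: finite_PiE finite_block)
    then show ?thesis by (simp only: card_multisets_of_size card_block add.commute)
  qed
  then have "card (\<Pi>\<^sub>E j\<in>blocks. multisets_of_size (\<Pi>\<^sub>E i\<in>block j. {1..r i}) d) =
      (\<Prod>j\<in>blocks. (d + (\<Prod>i\<in>block j. r i) - 1) choose d)"
    by (subst card_PiE) (simp_all add: blocks_def)
  also have "\<dots> = ((d + (\<Prod>j=max s t + 1..n. r j) - 1) choose d) * (\<Prod>i=s+1..t. ((d + r i - 1) choose d))"
    by (simp add: blocks_def block_def)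
  finally show ?thesis
    unfolding tallies_def by (simp only: card_cartesian_product 1 mult.assoc)
qed

section \<open>The ideal of swaps\<close>

abbreviation "V \<equiv> var_set n r s"

definition cls :: "(nat \<Rightarrow> nat) \<Rightarrow> (nat \<Rightarrow> nat) set" where
  "cls a = s_equiv n r s `` {a}"

definition rep :: "(nat \<Rightarrow> nat) set \<Rightarrow> nat \<Rightarrow> nat" where
  "rep v = (SOME a. a \<in> v)"

lemma equiv_s_equiv: "equiv N (s_equiv n r s)"
  by (rule equivI) (auto simp: refl_on_def sym_def trans_def s_equiv_def)

lemma cls_eq: "(a, b) \<in> s_equiv n r s \<Longrightarrow> cls a = cls b"
  unfolding cls_def by (rule equiv_class_eq[OF equiv_s_equiv])

lemma cls_in_V: "a \<in> N \<Longrightarrow> cls a \<in> V"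
  by (simp add: cls_def var_set_def quotientI)

lemma rep_props:
  assumes "v \<in> V" shows "rep v \<in> N" "cls (rep v) = v"
proof -
  obtain a where a: "a \<in> N" "v = cls a"
    using assms by (auto simp: var_set_def cls_def elim: quotientE)
  then have "a \<in> v" using equiv_class_self[OF equiv_s_equiv] by (simp add: cls_def)
  then have "rep v \<in> v" unfolding rep_def by (rule someI[where P = "\<lambda>a. a \<in> v"])
  then have "(a, rep v) \<in> s_equiv n r s" by (simp add: a(2) cls_def)
  then show "rep v \<in> N" "cls (rep v) = v"
    using cls_eq a by (auto simp: s_equiv_iff)
qed

lemma rep_cls: "a \<in> N \<Longrightarrow> (rep (cls a), a) \<in> s_equiv n r s"
  using rep_props[OF cls_in_V, of a] eq_equiv_class_iff[OF equiv_s_equiv] by (simp add: cls_def)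

text \<open>The tally of a monomial, computed on representatives of its variables; \<open>fibre_of_mon\<close> shows that
  the representatives do not matter.\<close>

definition fibre_of :: "(nat \<Rightarrow> nat) set monomial \<Rightarrow> nat \<times> (nat \<Rightarrow> (nat \<Rightarrow> nat) multiset)" where
  "fibre_of m = tally (image_mset rep (mset_of m))"

definition mon :: "(nat \<Rightarrow> nat) multiset \<Rightarrow> (nat \<Rightarrow> nat) set monomial" where
  "mon A = mon_of (image_mset cls A)"

lemma mon_union: "mon (A + B) = mon A + mon B"
  by (simp add: mon_def mon_of_add)

lemma keys_mon:
  assumes "set_mset A \<subseteq> N" shows "Poly_Mapping.keys (mon A) \<subseteq> V"
proof -
  have "Poly_Mapping.keys (mon A) = cls ` set_mset A"
    unfolding set_mset_of[symmetric] mon_def by simp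
  also have "\<dots> \<subseteq> V" using assms cls_in_V by (intro image_subsetI) auto
  finally show ?thesis .
qed

lemma fibre_of_mon: "set_mset A \<subseteq> N \<Longrightarrow> fibre_of (mon A) = tally A"
proof (induction A)
  case (add a A)
  have "tally (image_mset rep (image_mset cls A)) = tally A"
    using add by (simp add: fibre_of_def mon_def)
  from tally_union_cong[OF this, of "{#rep (cls a)#}"]
  have "tally (add_mset (rep (cls a)) (image_mset rep (image_mset cls A))) = tally (add_mset (rep (cls a)) A)"
    by simp
  also have "\<dots> = tally (add_mset a A)"
    using tally_union_cong[OF tally_s_equiv[OF rep_cls], of a A] add.prems by simp
  finally show ?case by (simp add: fibre_of_def mon_def)
qed (simp add: fibre_of_def mon_def)

lemma fibre_of_add_cong: "fibre_of u = fibre_of v \<Longrightarrow> fibre_of (m + u) = fibre_of (m + v)"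
  unfolding fibre_of_def mset_of_add image_mset_union by (rule tally_union_cong)

lemma monomials_eq_mon: "monomials_of_degree V d = mon ` {A. set_mset A \<subseteq> N \<and> size A = d}"
proof
  show "mon ` {A. set_mset A \<subseteq> N \<and> size A = d} \<subseteq> monomials_of_degree V d"
    unfolding monomials_of_degree_mset mon_def by (auto intro!: imageI cls_in_V)
  show "monomials_of_degree V d \<subseteq> mon ` {A. set_mset A \<subseteq> N \<and> size A = d}"
  proof
    fix m assume "m \<in> monomials_of_degree V d"
    then obtain M where M: "set_mset M \<subseteq> V" "size M = d" "m = mon_of M"
      by (auto simp: monomials_of_degree_mset)
    have "image_mset (\<lambda>v. cls (rep v)) M = image_mset id M"
      using M rep_props by (intro image_mset_cong) auto
    then have "m = mon (image_mset rep M)"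
      using M by (simp add: mon_def multiset.map_comp o_def)
    then show "m \<in> mon ` {A. set_mset A \<subseteq> N \<and> size A = d}"
      using M rep_props(1) by (intro image_eqI[of _ _ "image_mset rep M"]) auto
  qed
qed

lemma f_gen_eq:
  "f_gen n r s i a b = Poly_Mapping.single (mon {#a, b#}) 1 -
     Poly_Mapping.single (mon {#sw i a b, sw i b a#}) (1 :: 'k::field)"
  by (simp add: f_gen_def xvar_def Var_def mult_single mon_def mon_of_def cls_def)

abbreviation swap_ideal :: "((nat \<Rightarrow> nat) set, 'k::field) mpoly set" where
  "swap_ideal \<equiv> I_tilde n r s t"

abbreviation swap_gens :: "((nat \<Rightarrow> nat) set, 'k::field) mpoly set" where
  "swap_gens \<equiv> {f_gen n r s i a b | i a b. i \<in> {1..t} \<and> a \<in> N \<and> b \<in> N}"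

text \<open>A swap preserves the tally, so the two monomials of a generator lie in the same fibre, and their
  coefficients \<open>1\<close> and \<open>-1\<close> cancel in each functional that is constant on fibres.\<close>

lemma f_gen_fibre_null:
  assumes "i \<in> {1..t}" "a \<in> N" "b \<in> N"
  shows "(f_gen n r s i a b :: (_, 'k::field) mpoly) \<in> fibre_null V fibre_of"
proof -
  let ?u = "mon {#a, b#}" and ?v = "mon {#sw i a b, sw i b a#}"
  have N: "sw i a b \<in> N" "sw i b a \<in> N" using sw_in_N assms by auto
  have ab: "set_mset {#a, b#} \<subseteq> N" "set_mset {#sw i a b, sw i b a#} \<subseteq> N"
    using N assms by auto
  have "fibre_of ?u = fibre_of ?v"
    unfolding fibre_of_mon[OF ab(1)] fibre_of_mon[OF ab(2)] by (rule tally_swap[OF assms(2,3,1)])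
  then have "g ?u = g ?v" if "constant_on_fibres fibre_of g" for g :: "_ \<Rightarrow> 'k"
    using that unfolding constant_on_fibres_def by blast
  then have "functional g (f_gen n r s i a b) = 0" if "constant_on_fibres fibre_of g" for g :: "_ \<Rightarrow> 'k"
    using that functional_add[of g "Poly_Mapping.single ?u 1" "- Poly_Mapping.single ?v 1"]
    by (simp add: f_gen_eq functional_uminus functional_single)
  moreover have "(f_gen n r s i a b :: (_, 'k) mpoly) \<in> carrier (poly_ring V)"
    unfolding f_gen_eq by (intro diff_in_poly_ring single_in_poly_ring keys_mon ab)
  ultimately show ?thesis
    unfolding fibre_null_def by blast
qed

lemma swap_gens_carrier: "(swap_gens :: (_, 'k::field) mpoly set) \<subseteq> carrier (poly_ring V)"
proof
  fix p :: "(_, 'k) mpoly" assume "p \<in> swap_gens"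
  then have "p \<in> fibre_null V fibre_of" using f_gen_fibre_null by blast
  then show "p \<in> carrier (poly_ring V)" unfolding fibre_null_def by blast
qed

lemma swap_ideal_ideal: "ideal (swap_ideal :: (_, 'k::field) mpoly set) (poly_ring V)"
  unfolding I_tilde_def
  by (rule ring.genideal_ideal[OF cring.axioms(1)[OF poly_ring_cring] swap_gens_carrier])

lemma swap_ideal_fibre_null: "(swap_ideal :: (_, 'k::field) mpoly set) \<subseteq> fibre_null V fibre_of"
  unfolding I_tilde_def
proof (rule ring.genideal_minimal[OF cring.axioms(1)[OF poly_ring_cring]])
  show "ideal (fibre_null V fibre_of :: (_, 'k) mpoly set) (poly_ring V)"
    by (rule fibre_null_ideal) (rule fibre_of_add_cong)
  show "(swap_gens :: (_, 'k) mpoly set) \<subseteq> fibre_null V fibre_of"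
    using f_gen_fibre_null by blast
qed

text \<open>Chains of swaps become telescoping sums of monomial multiples of generators.\<close>

lemma conn_imp_diff_in_ideal:
  assumes "conn A B"
  shows "Poly_Mapping.single (mon A) 1 - Poly_Mapping.single (mon B) 1 \<in> (swap_ideal :: (_, 'k::field) mpoly set)"
  using assms
proof (induction rule: conn.induct)
  interpret I: ideal "swap_ideal :: (_, 'k) mpoly set" "poly_ring V" by (rule swap_ideal_ideal)
  have zero: "(0 :: (_, 'k) mpoly) \<in> swap_ideal"
    using additive_subgroup.zero_closed[OF I.is_additive_subgroup] by (simp add: poly_ring_simps)
  {
    case (swap a b i C)
    let ?C = "Poly_Mapping.single (mon C) (1 :: 'k)"
    have "(f_gen n r s i a b :: (_, 'k) mpoly) \<in> swap_ideal"
      using ring.genideal_self[OF cring.axioms(1)[OF poly_ring_cring] swap_gens_carrier] swap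
      unfolding I_tilde_def by blast
    then have "f_gen n r s i a b * ?C \<in> swap_ideal"
      using I.I_r_closed[of _ ?C] keys_mon[OF swap(4)] by (simp add: poly_ring_simps single_in_poly_ring)
    then show ?case
      using mon_union[of "{#a, b#}" C] mon_union[of "{#sw i a b, sw i b a#}" C]
      by (simp add: f_gen_eq left_diff_distrib mult_single)
  next
    case (equiv a b C)
    then show ?case
      using cls_eq[OF equiv(1)] zero by (simp add: mon_def)
  next
    case (refl A)
    show ?case using zero by simp
  next
    case (sym A B)
    have "- 1 \<in> carrier (poly_ring V :: (_, 'k) mpoly ring)"
      using uminus_in_poly_ring[OF one_in_poly_ring] .
    from I.I_r_closed[OF sym(2) this] show ?case by (simp add: poly_ring_simps)
  next
    case (trans A B C)
    then show ?case using additive_subgroup.a_closed[OF I.is_additive_subgroup trans(3,4)] by (simp add: poly_ring_simps)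
  }
qed

theorem hilbert_function_swap_ideal:
  "hilbert_function V (swap_ideal :: (_, 'k::field) mpoly set) d = card (tallies d)"
proof -
  have image: "fibre_of ` monomials_of_degree V d = tallies d"
  proof -
    have "fibre_of ` monomials_of_degree V d = tally ` {A. set_mset A \<subseteq> N \<and> size A = d}"
      unfolding monomials_eq_mon image_image by (intro image_cong) (auto simp: fibre_of_mon)
    then show ?thesis by (simp add: tally_image)
  qed
  have "hilbert_function V (swap_ideal :: (_, 'k) mpoly set) d = card (fibre_of ` monomials_of_degree V d)"
  proof (rule hilbert_function_eq_card_fibres[OF swap_ideal_ideal swap_ideal_fibre_null])
    show "finite (fibre_of ` monomials_of_degree V d)" by (simp add: image finite_tallies)
    fix u v assume uv: "u \<in> monomials_of_degree V d" "v \<in> monomials_of_degree V d" "fibre_of u = fibre_of v"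
    then obtain A B where "u = mon A" "set_mset A \<subseteq> N" "v = mon B" "set_mset B \<subseteq> N"
      unfolding monomials_eq_mon by blast
    then show "Poly_Mapping.single u 1 - Poly_Mapping.single v 1 \<in> (swap_ideal :: (_, 'k) mpoly set)"
      using uv(3) conn_imp_diff_in_ideal[OF fibres_connected] by (simp add: fibre_of_mon)
  qed
  then show ?thesis by (simp add: image)
qed

end

text \<open>With \<open>u = max s t\<close> the count specialises to \<open>u = t\<close> in the first case and to \<open>u = s\<close> in the second,
  where the product over \<open>{s+1..t}\<close> is empty.\<close>

theorem corollary3p7:
  fixes n s t d :: nat and r :: "nat \<Rightarrow> nat"
  assumes "n \<ge> 1"
    and "\<And>i. i \<in> {1..n} \<Longrightarrow> r i \<ge> 2"
    and "s \<in> {1..n}" and "t \<in> {1..n}"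
  shows
    "(2 \<le> s \<and> s \<le> t \<longrightarrow>
        hilbert_function (var_set n r s) (I_tilde n r s t :: (_, 'k::field) mpoly set) d =
          (d * (\<Sum>j=1..s. (r j - 1)) + 1)
          * ((d + (\<Prod>j=t+1..n. r j) - 1) choose d)
          * (\<Prod>i=s+1..t. ((d + r i - 1) choose d)))
     \<and> (s \<ge> t \<and> s \<ge> 2 \<longrightarrow>
        hilbert_function (var_set n r s) (I_tilde n r s t :: (_, 'k::field) mpoly set) d =
          (d * (\<Sum>j=1..s. (r j - 1)) + 1)
          * ((d + (\<Prod>j=s+1..n. r j) - 1) choose d))"
proof (cases "2 \<le> s")
  case True
  then interpret partial_segre n s t r
    by unfold_locales (use assms in auto)
  show ?thesis
    using hilbert_function_swap_ideal[where 'k = 'k, of d] card_tallies[of d]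
    by (auto simp: max_def)
qed simp

end
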